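(* Let $\mathbf q\colon E\to M$ be a differential bundle in a tangent category $(\mathbb X,\mathbb T)$, and let $R\colon TE\to Vq$ and $H\colon Fq\to TE$ be two morphisms. The following are equivalent: (1) $(R,H)$ is a linear Ehresmann connection on $\mathbf q$; (2) $(K_R,H)$ is a Koszul connection on $\mathbf q$, where $K_R:=\{R\iota_q\}_q\colon TE\to E$.
   Context: Composition is diagrammatic: $fg$ is $f$ followed by $g$; $\langle f,g\rangle$ denotes pairing into a (fibred) product, with projections $\pi_1,\pi_2$. A tangent category $(\mathbb X,\mathbb T)$ is a category $\mathbb X$ with an endofunctor $T$ and natural transformations $p_M\colon TM\to M$, $z_M\colon M\to TM$, $s_M\colon T_2M\to TM$, $l_M\colon TM\to T^2M$, $c_M\colon T^2M\to T^2M$, where the $n$-fold pullback $T_nM$ of $p_M$ along itself exists and is preserved by all $T^m$, such that: $(p_M,z_M,s_M)$ is an additive bundle (a commutative monoid in the category over $M$); $(z_M,l_M)\colon p_M\to Tp_M$ and $(\mathrm{id}_{TM},c_M)\colon Tp_M\to p_{TM}$ are additive bundle morphisms (commutative squares preserving zero and sum); $c_Mc_M=\mathrm{id}$, $l_Mc_M=l_M$, $l_M\,Tl_M=l_M\,l_{TM}$, $Tc_M\,c_{TM}\,Tc_M=c_{TM}\,Tc_M\,c_{TM}$, $l_{TM}\,Tc_M\,c_{TM}=c_M\,Tl_M$; and, with $\xi_M=\langle\pi_1l_M,\pi_2z_{TM}\rangle\,Ts_M\colon T_2M\to T^2M$, the square $\xi_M\,Tp_M=\pi_1p_Mz_M$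 is a tangent pullback. A tangent pullback is a pullback preserved by $T^m$ for all $m\ge0$. A tangent display map is a morphism $q\colon E\to M$ such that for all $n\ge0$ and all $f\colon N\to T^nM$ the pullback of $T^nq$ along $f$ exists and is a tangent pullback. A differential bundle $\mathbf q\colon E\to M$ consists of $q\colon E\to M$, $z_q\colon M\to E$, $s_q\colon E_2\to E$, $l_q\colon E\to TE$ ($E_n$ the $n$-fold pullback of $q$ along itself, required to exist and be preserved by all $T^m$) such that $(q,z_q,s_q)$ is an additive bundle, $(z_M,l_q)\colon q\to Tq$ and $(z_q,l_q)\colon q\to p_E$ are additive bundle morphisms, $l_ql_E=l_q\,Tl_q$, and with $\xi_q=\langle\pi_1l_q,\pi_2z_E\rangle\,Ts_q\colon E_2\to TE$ the square $\xi_q\,Tq=\pi_1qz_M$ is a tangent pullback. Convention: all differential bundles are assumed display, i.e. $q$ is a tangent display map. A morphism $(f,g)\colon\mathbf q\to\mathbf q'$ (with $qf=gq'$) is linear if $g\,l_{q'}=l_q\,Tg$. $\mathbf p_E=(p_E,z_E,s_E,l_E)$ is the tangent bundle. For a morphism $f\colon N\to TE$ with $f\,Tq=f\,Tq\,p_Mz_M$, let $\tilde f\colon N\to E_2$ be the unique morphism with $\tilde f\xi_q=f$ and $\tilde f\pi_1q=f\,Tq\,p_M$; put $\{f\}_q:=\tilde f\pi_1\colon N\to E$. For a tangent display map $q\colon E\to M$: the vertical bundle $\mathbf q^V\colon Vq\to E$ is given by the tangent pullback $Vq$ of $Tq$ along $z_M$, with projections $\iota_q\colon Vq\to TE$ and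 $T^Vq\colon Vq\to M$ (so $\{R\iota_q\}_q$ is defined for every morphism $R\colon TE\to Vq$, because $\iota_q\,Tq=T^Vq\,z_M$); $q^V=\iota_qp_E$, and its zero $z_q^V$, sum $s^V_q$, lift $l_q^V$ are determined by $z_q^V\iota_q=z_E$, $s_q^V\iota_q=(\iota_q\times\iota_q)s_E$, $l_q^V\,T\iota_q=\iota_ql_E$. The Finsler bundle $\mathbf q^F\colon Fq\to E$ is given by the tangent pullback $Fq$ of $q$ along $p_M$, with projections $q^F\colon Fq\to E$ and $T^Fq\colon Fq\to TM$, its zero $z_q^F$, sum $s_q^F$, lift $l_q^F$ determined by $z_q^Fq^F=\mathrm{id}_E$, $z_q^F\,T^Fq=qz_M$; $s_q^Fq^F=\pi_1q^F$, $s_q^F\,T^Fq=(T^Fq\times T^Fq)s_M$; $l_q^F\,Tq^F=q^Fz_E$, $l_q^F\,T(T^Fq)=T^Fq\,l_M$. The horizontal descent $\pi_q\colon TE\to Fq$ is the unique morphism with $\pi_qq^F=p_E$ and $\pi_q\,T^Fq=Tq$. When $\mathbf q$ is a differential bundle, there are further differential bundles: $T\mathbf q\colon TE\to TM$ with projection $Tq$, zero $Tz_q$, sum $Ts_q$ and lift $l_{Tq}=Tl_q\,c_E$; $T^F\mathbf q\colon Fq\to TM$ (projection $T^Fq$), the pullback of $\mathbf q$ along $p_M$, with lift $l_{T^Fq}$ determined by $l_{T^Fq}\,Tq^F=q^Fl_q$, $l_{T^Fq}\,T(T^Fq)=T^Fq\,z_{TM}$; and $T^V\mathbf q\colon Vq\to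 M$ (projection $T^Vq$), the pullback of $T\mathbf q$ along $z_M$, with lift $l_{T^V\mathbf q}$ determined by $l_{T^V\mathbf q}\,T\iota_q=\iota_q\,Tl_q\,c_E$, $l_{T^V\mathbf q}\,T(T^Vq)=T^Vq\,z_M$. A vertical connection on $q$ is $R\colon TE\to Vq$ with $\iota_qR=\mathrm{id}_{Vq}$ and $R\colon\mathbf p_E\to\mathbf q^V$ linear over $E$ ($Rq^V=p_E$, $Rl_q^V=l_E\,TR$). A horizontal connection on $q$ is $H\colon Fq\to TE$ with $H\pi_q=\mathrm{id}_{Fq}$ and $H\colon\mathbf q^F\to\mathbf p_E$ linear over $E$ ($Hp_E=q^F$, $Hl_E=l_q^F\,TH$). An Ehresmann connection on $q$ is a pair $(R,H)$ of a vertical and a horizontal connection with $HR=q^Fz_q^V$ and $\langle R\iota_q,\pi_qH\rangle s_E=\mathrm{id}_{TE}$. A linear Ehresmann connection on the differential bundle $\mathbf q$ is an Ehresmann connection $(R,H)$ on $q$ such that $(p_M,R)\colon T\mathbf q\to T^V\mathbf q$ is linear ($R\,l_{T^V\mathbf q}=Tl_q\,c_E\,TR$) and $(\mathrm{id}_{TM},H)\colon T^F\mathbf q\to T\mathbf q$ is linear ($H\,Tl_q\,c_E=l_{T^Fq}\,TH$). A vertical Koszul connection on $\mathbf q$ is $K\colon TE\to E$ with $l_qK=\mathrm{id}_E$, $(p_M,K)\colon T\mathbf q\to\mathbf q$ linear ($Kq=Tq\,p_M$, $Kl_q=Tl_q\,c_E\,TK$) and $(q,K)\colon\mathbf p_E\to\mathbf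 q$ linear ($Kq=p_Eq$, $Kl_q=l_E\,TK$). A horizontal Koszul connection on $\mathbf q$ is $H\colon Fq\to TE$ with $H\pi_q=\mathrm{id}_{Fq}$, $(\mathrm{id}_E,H)\colon\mathbf q^F\to\mathbf p_E$ linear, and $(\mathrm{id}_{TM},H)\colon T^F\mathbf q\to T\mathbf q$ linear. A Koszul connection on $\mathbf q$ is a pair $(K,H)$ of a vertical and a horizontal Koszul connection with $HK=q^F\,q\,z_q$ and $\langle\langle K,p_E\rangle\xi_q,\pi_qH\rangle s_E=\mathrm{id}_{TE}$.
   Formalization: The morphism R is additionally assumed to lie over E, i.e. R q^V = p_E; this is part of (1), but without it (2) does not imply (1) (linear spaces, M=0, E=ℝ, R(x,v)=(0,v), H=z_E). *)

theory Defs
  imports Main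
begin

section \<open>Categories\<close>

text \<open>Composition is diagrammatic: \<open>f \<Zsemi> g\<close> is \<open>f\<close> followed by \<open>g\<close>.\<close>

record ('o, 'm) category =
  Obj :: "'o set"
  Arr :: "'m set"
  Dom :: "'m \<Rightarrow> 'o"
  Cod :: "'m \<Rightarrow> 'o"
  Id :: "'o \<Rightarrow> 'm"
  Comp :: "'m \<Rightarrow> 'm \<Rightarrow> 'm"  (infixl "\<Zsemi>\<index>" 70)

definition hom :: "('o, 'm, 'x) category_scheme \<Rightarrow> 'o \<Rightarrow> 'o \<Rightarrow> 'm set"
  where "hom C A B = {f \<in> Arr C. Dom C f = A \<and> Cod C f = B}"

locale category =
  fixes C :: "('o, 'm, 'x) category_scheme" (structure)
  assumes Dom_Obj: "f \<in> Arr C \<Longrightarrow> Dom C f \<in> Obj C"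
    and Cod_Obj: "f \<in> Arr C \<Longrightarrow> Cod C f \<in> Obj C"
    and Id_hom: "A \<in> Obj C \<Longrightarrow> Id C A \<in> hom C A A"
    and Comp_hom: "\<lbrakk>f \<in> hom C A B; g \<in> hom C B D\<rbrakk> \<Longrightarrow> f \<Zsemi> g \<in> hom C A D"
    and Id_left: "f \<in> hom C A B \<Longrightarrow> Id C A \<Zsemi> f = f"
    and Id_right: "f \<in> hom C A B \<Longrightarrow> f \<Zsemi> Id C B = f"
    and Comp_assoc: "\<lbrakk>f \<in> hom C A B; g \<in> hom C B D; h \<in> hom C D E\<rbrakk>
      \<Longrightarrow> (f \<Zsemi> g) \<Zsemi> h = f \<Zsemi> (g \<Zsemi> h)"

context
  fixes C :: "('o, 'm, 'x) category_scheme" (structure)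
begin

text \<open>The square \<open>a \<Zsemi> f = b \<Zsemi> g\<close> is a pullback of \<open>f\<close> along \<open>g\<close>; its apex is the domain
  of \<open>a\<close>.\<close>

definition pullback :: "'m \<Rightarrow> 'm \<Rightarrow> 'm \<Rightarrow> 'm \<Rightarrow> bool"
  where "pullback a b f g \<longleftrightarrow>
    f \<in> Arr C \<and> g \<in> Arr C \<and> Cod C f = Cod C g \<and>
    a \<in> hom C (Dom C a) (Dom C f) \<and> b \<in> hom C (Dom C a) (Dom C g) \<and>
    a \<Zsemi> f = b \<Zsemi> g \<and>
    (\<forall>N x y. x \<in> hom C N (Dom C f) \<and> y \<in> hom C N (Dom C g) \<and> x \<Zsemi> f = y \<Zsemi> g \<longrightarrow>
      (\<exists>!h. h \<in> hom C N (Dom C a) \<and> h \<Zsemi> a = x \<and> h \<Zsemi> b = y))"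

text \<open>The pairing \<open>\<langle>x, y\<rangle>\<close> into a pullback with projections \<open>a\<close> and \<open>b\<close>.\<close>

definition pairing :: "'m \<Rightarrow> 'm \<Rightarrow> 'm \<Rightarrow> 'm \<Rightarrow> 'm"
  where "pairing a b x y =
    (THE h. h \<in> hom C (Dom C x) (Dom C a) \<and> h \<Zsemi> a = x \<and> h \<Zsemi> b = y)"

text \<open>The \<open>n\<close>-fold pullback of \<open>q\<close> along itself, with projections \<open>\<pi> 0, \<dots>, \<pi> (n - 1)\<close>.
  The projection \<open>r\<close> to the base is recorded too, so that the 0-fold pullback is the base.\<close>

definition fibre_power :: "nat \<Rightarrow> 'm \<Rightarrow> 'm \<Rightarrow> (nat \<Rightarrow> 'm) \<Rightarrow> bool"
  where "fibre_power n q r \<pi> \<longleftrightarrow>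
    q \<in> Arr C \<and> r \<in> hom C (Dom C r) (Cod C q) \<and>
    (\<forall>i<n. \<pi> i \<in> hom C (Dom C r) (Dom C q) \<and> \<pi> i \<Zsemi> q = r) \<and>
    (\<forall>N y x. y \<in> hom C N (Cod C q) \<and>
        (\<forall>i<n. x i \<in> hom C N (Dom C q) \<and> x i \<Zsemi> q = y) \<longrightarrow>
      (\<exists>!h. h \<in> hom C N (Dom C r) \<and> h \<Zsemi> r = y \<and> (\<forall>i<n. h \<Zsemi> \<pi> i = x i)))"

end


section \<open>Bundle data\<close>

text \<open>A bundle \<open>q: E \<rightarrow> M\<close> with zero, sum and lift. The sum is defined on the fibre square \<open>E\<^sub>2\<close>,
  whose projections \<open>bfst\<close>, \<open>bsnd\<close> are part of the data; \<open>E\<close>, \<open>M\<close>, \<open>E\<^sub>2\<close> are read off as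
  domains and codomains.\<close>

record 'm bundle_data =
  bproj :: 'm
  bzero :: 'm
  bfst :: 'm
  bsnd :: 'm
  badd :: 'm
  blift :: 'm

context
  fixes C :: "('o, 'm, 'x) category_scheme" (structure)
begin

text \<open>A commutative monoid in the slice over \<open>M\<close>. Associativity is the usual diagram on the
  3-fold pullback \<open>E\<^sub>3\<close>.\<close>

definition additive_bundle :: "'m bundle_data \<Rightarrow> bool"
  where "additive_bundle q \<longleftrightarrow>
    (let E = Dom C (bproj q); M = Cod C (bproj q);
         pr = pairing C (bfst q) (bsnd q) in
      bproj q \<in> Arr C \<and>
      pullback C (bfst q) (bsnd q) (bproj q) (bproj q) \<and>
      bzero q \<in> hom C M E \<and> bzero q \<Zsemi> bproj q = Id C M \<and>
      badd q \<in> hom C (Dom C (bfst q)) E \<and> badd q \<Zsemi> bproj q = bfst q \<Zsemi> bproj q \<and>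
      pr (bproj q \<Zsemi> bzero q) (Id C E) \<Zsemi> badd q = Id C E \<and>
      pr (bsnd q) (bfst q) \<Zsemi> badd q = badd q \<and>
      (\<forall>r \<pi>. fibre_power C 3 (bproj q) r \<pi> \<longrightarrow>
        pr (pr (\<pi> 0) (\<pi> 1) \<Zsemi> badd q) (\<pi> 2) \<Zsemi> badd q =
        pr (\<pi> 0) (pr (\<pi> 1) (\<pi> 2) \<Zsemi> badd q) \<Zsemi> badd q))"

definition additive_bundle_morphism :: "'m \<Rightarrow> 'm \<Rightarrow> 'm bundle_data \<Rightarrow> 'm bundle_data \<Rightarrow> bool"
  where "additive_bundle_morphism f g q q' \<longleftrightarrow>
    f \<in> hom C (Cod C (bproj q)) (Cod C (bproj q')) \<and>
    g \<in> hom C (Dom C (bproj q)) (Dom C (bproj q')) \<and>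
    g \<Zsemi> bproj q' = bproj q \<Zsemi> f \<and>
    bzero q \<Zsemi> g = f \<Zsemi> bzero q' \<and>
    badd q \<Zsemi> g = pairing C (bfst q') (bsnd q') (bfst q \<Zsemi> g) (bsnd q \<Zsemi> g) \<Zsemi> badd q'"

end


section \<open>Tangent categories\<close>

text \<open>\<open>Tfst M\<close>, \<open>Tsnd M\<close> are the projections \<open>T\<^sub>2 M \<rightarrow> T M\<close> of the fibre square of \<open>p\<^sub>M\<close>.\<close>

record ('o, 'm) tangent_data = "('o, 'm) category" +
  TObj :: "'o \<Rightarrow> 'o"
  TArr :: "'m \<Rightarrow> 'm"
  Tproj :: "'o \<Rightarrow> 'm"
  Tzero :: "'o \<Rightarrow> 'm"
  Tfst :: "'o \<Rightarrow> 'm"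
  Tsnd :: "'o \<Rightarrow> 'm"
  Tadd :: "'o \<Rightarrow> 'm"
  Tlift :: "'o \<Rightarrow> 'm"
  Tflip :: "'o \<Rightarrow> 'm"

context
  fixes X :: "('o, 'm) tangent_data" (structure)
begin

definition tangent_pullback :: "'m \<Rightarrow> 'm \<Rightarrow> 'm \<Rightarrow> 'm \<Rightarrow> bool"
  where "tangent_pullback a b f g \<longleftrightarrow>
    (\<forall>m. pullback X ((TArr X ^^ m) a) ((TArr X ^^ m) b) ((TArr X ^^ m) f) ((TArr X ^^ m) g))"

definition has_tangent_fibre_powers :: "'m bundle_data \<Rightarrow> bool"
  where "has_tangent_fibre_powers q \<longleftrightarrow>
    tangent_pullback (bfst q) (bsnd q) (bproj q) (bproj q) \<and>
    (\<forall>n. \<exists>r \<pi>. \<forall>m.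
      fibre_power X n ((TArr X ^^ m) (bproj q)) ((TArr X ^^ m) r) (\<lambda>i. (TArr X ^^ m) (\<pi> i)))"

definition tangent_bundle :: "'o \<Rightarrow> 'm bundle_data"
  where "tangent_bundle M =
    \<lparr>bproj = Tproj X M, bzero = Tzero X M, bfst = Tfst X M, bsnd = Tsnd X M,
     badd = Tadd X M, blift = Tlift X M\<rparr>"

text \<open>\<open>Tq\<close>, with lift \<open>Tl\<^sub>q c\<^sub>E\<close>.\<close>

definition T_bundle :: "'m bundle_data \<Rightarrow> 'm bundle_data"
  where "T_bundle q =
    \<lparr>bproj = TArr X (bproj q), bzero = TArr X (bzero q),
     bfst = TArr X (bfst q), bsnd = TArr X (bsnd q), badd = TArr X (badd q),
     blift = TArr X (blift q) \<Zsemi> Tflip X (Dom X (bproj q))\<rparr>"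

text \<open>\<open>\<xi>\<^sub>q = \<langle>\<pi>\<^sub>1 l\<^sub>q, \<pi>\<^sub>2 z\<^sub>E\<rangle> Ts\<^sub>q\<close>, where the pairing is into \<open>T E\<^sub>2\<close>.\<close>

definition xi :: "'m bundle_data \<Rightarrow> 'm"
  where "xi q =
    pairing X (TArr X (bfst q)) (TArr X (bsnd q))
      (bfst q \<Zsemi> blift q) (bsnd q \<Zsemi> Tzero X (Dom X (bproj q))) \<Zsemi> TArr X (badd q)"

definition universal_lift :: "'m bundle_data \<Rightarrow> bool"
  where "universal_lift q \<longleftrightarrow>
    tangent_pullback (xi q) (bfst q \<Zsemi> bproj q) (TArr X (bproj q)) (Tzero X (Cod X (bproj q)))"

end

locale tangent_category = category X for X :: "('o, 'm) tangent_data" (structure) +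
  assumes TObj: "M \<in> Obj X \<Longrightarrow> TObj X M \<in> Obj X"
    and TArr: "f \<in> hom X M N \<Longrightarrow> TArr X f \<in> hom X (TObj X M) (TObj X N)"
    and TArr_Id: "M \<in> Obj X \<Longrightarrow> TArr X (Id X M) = Id X (TObj X M)"
    and TArr_Comp: "\<lbrakk>f \<in> hom X M N; g \<in> hom X N P\<rbrakk> \<Longrightarrow> TArr X (f \<Zsemi> g) = TArr X f \<Zsemi> TArr X g"
    \<comment> \<open>typing of the structure maps\<close>
    and Tproj_hom: "M \<in> Obj X \<Longrightarrow> Tproj X M \<in> hom X (TObj X M) M"
    and Tzero_hom: "M \<in> Obj X \<Longrightarrow> Tzero X M \<in> hom X M (TObj X M)"
    and Tadd_hom: "M \<in> Obj X \<Longrightarrow> Tadd X M \<in> hom X (Dom X (Tfst X M)) (TObj X M)"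
    and Tlift_hom: "M \<in> Obj X \<Longrightarrow> Tlift X M \<in> hom X (TObj X M) (TObj X (TObj X M))"
    and Tflip_hom: "M \<in> Obj X \<Longrightarrow> Tflip X M \<in> hom X (TObj X (TObj X M)) (TObj X (TObj X M))"
    \<comment> \<open>fibre powers of \<open>p\<^sub>M\<close>, in particular \<open>T\<^sub>2 M\<close>\<close>
    and T_powers: "M \<in> Obj X \<Longrightarrow> has_tangent_fibre_powers X (tangent_bundle X M)"
    \<comment> \<open>naturality\<close>
    and Tproj_nat: "f \<in> hom X M N \<Longrightarrow> TArr X f \<Zsemi> Tproj X N = Tproj X M \<Zsemi> f"
    and Tzero_nat: "f \<in> hom X M N \<Longrightarrow> f \<Zsemi> Tzero X N = Tzero X M \<Zsemi> TArr X f"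
    and Tadd_nat: "f \<in> hom X M N \<Longrightarrow>
      pairing X (Tfst X N) (Tsnd X N) (Tfst X M \<Zsemi> TArr X f) (Tsnd X M \<Zsemi> TArr X f) \<Zsemi> Tadd X N
        = Tadd X M \<Zsemi> TArr X f"
    and Tlift_nat: "f \<in> hom X M N \<Longrightarrow>
      TArr X f \<Zsemi> Tlift X N = Tlift X M \<Zsemi> TArr X (TArr X f)"
    and Tflip_nat: "f \<in> hom X M N \<Longrightarrow>
      TArr X (TArr X f) \<Zsemi> Tflip X N = Tflip X M \<Zsemi> TArr X (TArr X f)"
    \<comment> \<open>additivity\<close>
    and T_additive: "M \<in> Obj X \<Longrightarrow> additive_bundle X (tangent_bundle X M)"
    and Tlift_additive: "M \<in> Obj X \<Longrightarrow>
      additive_bundle_morphism X (Tzero X M) (Tlift X M)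
        (tangent_bundle X M) (T_bundle X (tangent_bundle X M))"
    and Tflip_additive: "M \<in> Obj X \<Longrightarrow>
      additive_bundle_morphism X (Id X (TObj X M)) (Tflip X M)
        (T_bundle X (tangent_bundle X M)) (tangent_bundle X (TObj X M))"
    \<comment> \<open>coherence of lift and flip\<close>
    and Tflip_Tflip: "M \<in> Obj X \<Longrightarrow> Tflip X M \<Zsemi> Tflip X M = Id X (TObj X (TObj X M))"
    and Tlift_Tflip: "M \<in> Obj X \<Longrightarrow> Tlift X M \<Zsemi> Tflip X M = Tlift X M"
    and Tlift_Tlift: "M \<in> Obj X \<Longrightarrow>
      Tlift X M \<Zsemi> TArr X (Tlift X M) = Tlift X M \<Zsemi> Tlift X (TObj X M)"
    and Tflip_braid: "M \<in> Obj X \<Longrightarrow>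
      TArr X (Tflip X M) \<Zsemi> Tflip X (TObj X M) \<Zsemi> TArr X (Tflip X M)
        = Tflip X (TObj X M) \<Zsemi> TArr X (Tflip X M) \<Zsemi> Tflip X (TObj X M)"
    and Tlift_Tflip_coherence: "M \<in> Obj X \<Longrightarrow>
      Tlift X (TObj X M) \<Zsemi> TArr X (Tflip X M) \<Zsemi> Tflip X (TObj X M)
        = Tflip X M \<Zsemi> TArr X (Tlift X M)"
    and Tlift_universal: "M \<in> Obj X \<Longrightarrow> universal_lift X (tangent_bundle X M)"


section \<open>Differential bundles\<close>

context
  fixes X :: "('o, 'm) tangent_data" (structure)
begin

definition tangent_display_map :: "'m \<Rightarrow> bool"
  where "tangent_display_map q \<longleftrightarrow>
    q \<in> Arr X \<and>
    (\<forall>n f. f \<in> Arr X \<and> Cod X f = (TObj X ^^ n) (Cod X q) \<longrightarrow>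
      (\<exists>a b. tangent_pullback X a b ((TArr X ^^ n) q) f))"

text \<open>All differential bundles are display by convention.\<close>

definition differential_bundle :: "'m bundle_data \<Rightarrow> bool"
  where "differential_bundle q \<longleftrightarrow>
    (let E = Dom X (bproj q); M = Cod X (bproj q) in
      tangent_display_map (bproj q) \<and>
      has_tangent_fibre_powers X q \<and>
      additive_bundle X q \<and>
      blift q \<in> hom X E (TObj X E) \<and>
      additive_bundle_morphism X (Tzero X M) (blift q) q (T_bundle X q) \<and>
      additive_bundle_morphism X (bzero q) (blift q) q (tangent_bundle X E) \<and>
      blift q \<Zsemi> Tlift X E = blift q \<Zsemi> TArr X (blift q) \<and>
      universal_lift X q)"

definition linear_morphism :: "'m \<Rightarrow> 'm \<Rightarrow> 'm bundle_data \<Rightarrow> 'm bundle_data \<Rightarrow> bool"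
  where "linear_morphism f g q q' \<longleftrightarrow>
    f \<in> hom X (Cod X (bproj q)) (Cod X (bproj q')) \<and>
    g \<in> hom X (Dom X (bproj q)) (Dom X (bproj q')) \<and>
    bproj q \<Zsemi> f = g \<Zsemi> bproj q' \<and>
    g \<Zsemi> blift q' = blift q \<Zsemi> TArr X g"

text \<open>\<open>{f}\<^sub>q\<close>, for \<open>f: N \<rightarrow> TE\<close> with \<open>f Tq = f Tq p\<^sub>M z\<^sub>M\<close>. The pairing is into the
  pullback square of the universality of the lift, whose apex is \<open>E\<^sub>2\<close>.\<close>

definition bracket :: "'m bundle_data \<Rightarrow> 'm \<Rightarrow> 'm"
  where "bracket q f =
    pairing X (xi X q) (bfst q \<Zsemi> bproj q)
      f (f \<Zsemi> TArr X (bproj q) \<Zsemi> Tproj X (Cod X (bproj q))) \<Zsemi> bfst q"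


section \<open>Vertical and Finsler bundles\<close>

text \<open>The pullback objects \<open>Vq\<close> and \<open>Fq\<close> are given through their projections:
  \<open>\<iota>: Vq \<rightarrow> TE\<close>, \<open>TV: Vq \<rightarrow> M\<close> form a tangent pullback of \<open>Tq\<close> along \<open>z\<^sub>M\<close>, and
  \<open>qF: Fq \<rightarrow> E\<close>, \<open>TF: Fq \<rightarrow> TM\<close> form a tangent pullback of \<open>q\<close> along \<open>p\<^sub>M\<close>.
  The fibre squares carrying the sums of the bundles below are chosen arbitrarily.\<close>

definition is_vertical :: "'m \<Rightarrow> 'm \<Rightarrow> 'm \<Rightarrow> bool"
  where "is_vertical q \<iota> TV \<longleftrightarrow> tangent_pullback X \<iota> TV (TArr X q) (Tzero X (Cod X q))"

definition is_finsler :: "'m \<Rightarrow> 'm \<Rightarrow> 'm \<Rightarrow> bool"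
  where "is_finsler q qF TF \<longleftrightarrow> tangent_pullback X qF TF q (Tproj X (Cod X q))"

definition fibre_square :: "'m \<Rightarrow> 'm \<times> 'm"
  where "fibre_square q = (SOME (a, b). tangent_pullback X a b q q)"

definition vertical_bundle :: "'m \<Rightarrow> 'm \<Rightarrow> 'm bundle_data"
  where "vertical_bundle q \<iota> =
    (let E = Dom X q; V = Dom X \<iota>; qV = \<iota> \<Zsemi> Tproj X E; (a, b) = fibre_square qV in
      \<lparr>bproj = qV,
       bzero = (THE h. h \<in> hom X E V \<and> h \<Zsemi> \<iota> = Tzero X E),
       bfst = a, bsnd = b,
       badd = (THE h. h \<in> hom X (Dom X a) V \<and>
         h \<Zsemi> \<iota> = pairing X (Tfst X E) (Tsnd X E) (a \<Zsemi> \<iota>) (b \<Zsemi> \<iota>) \<Zsemi> Tadd X E),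
       blift = (THE h. h \<in> hom X V (TObj X V) \<and> h \<Zsemi> TArr X \<iota> = \<iota> \<Zsemi> Tlift X E)\<rparr>)"

definition finsler_bundle :: "'m \<Rightarrow> 'm \<Rightarrow> 'm \<Rightarrow> 'm bundle_data"
  where "finsler_bundle q qF TF =
    (let E = Dom X q; M = Cod X q; (a, b) = fibre_square qF in
      \<lparr>bproj = qF,
       bzero = pairing X qF TF (Id X E) (q \<Zsemi> Tzero X M),
       bfst = a, bsnd = b,
       badd = pairing X qF TF (a \<Zsemi> qF)
         (pairing X (Tfst X M) (Tsnd X M) (a \<Zsemi> TF) (b \<Zsemi> TF) \<Zsemi> Tadd X M),
       blift = pairing X (TArr X qF) (TArr X TF) (qF \<Zsemi> Tzero X E) (TF \<Zsemi> Tlift X M)\<rparr>)"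

definition horizontal_descent :: "'m \<Rightarrow> 'm \<Rightarrow> 'm \<Rightarrow> 'm"
  where "horizontal_descent q qF TF = pairing X qF TF (Tproj X (Dom X q)) (TArr X q)"

text \<open>\<open>T\<^sup>Fq: Fq \<rightarrow> TM\<close>, the pullback of the bundle \<open>q\<close> along \<open>p\<^sub>M\<close>.\<close>

definition TF_bundle :: "'m bundle_data \<Rightarrow> 'm \<Rightarrow> 'm \<Rightarrow> 'm bundle_data"
  where "TF_bundle q qF TF =
    (let M = Cod X (bproj q); (a, b) = fibre_square TF in
      \<lparr>bproj = TF,
       bzero = pairing X qF TF (Tproj X M \<Zsemi> bzero q) (Id X (TObj X M)),
       bfst = a, bsnd = b,
       badd = pairing X qF TF
         (pairing X (bfst q) (bsnd q) (a \<Zsemi> qF) (b \<Zsemi> qF) \<Zsemi> badd q) (a \<Zsemi> TF),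
       blift = pairing X (TArr X qF) (TArr X TF)
         (qF \<Zsemi> blift q) (TF \<Zsemi> Tzero X (TObj X M))\<rparr>)"

text \<open>\<open>T\<^sup>Vq: Vq \<rightarrow> M\<close>, the pullback of the bundle \<open>Tq\<close> along \<open>z\<^sub>M\<close>.\<close>

definition TV_bundle :: "'m bundle_data \<Rightarrow> 'm \<Rightarrow> 'm \<Rightarrow> 'm bundle_data"
  where "TV_bundle q \<iota> TV =
    (let M = Cod X (bproj q); Tq = T_bundle X q; (a, b) = fibre_square TV in
      \<lparr>bproj = TV,
       bzero = pairing X \<iota> TV (Tzero X M \<Zsemi> bzero Tq) (Id X M),
       bfst = a, bsnd = b,
       badd = pairing X \<iota> TV
         (pairing X (bfst Tq) (bsnd Tq) (a \<Zsemi> \<iota>) (b \<Zsemi> \<iota>) \<Zsemi> badd Tq) (a \<Zsemi> TV),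
       blift = pairing X (TArr X \<iota>) (TArr X TV)
         (\<iota> \<Zsemi> blift Tq) (TV \<Zsemi> Tzero X M)\<rparr>)"


section \<open>Connections\<close>

definition vertical_connection :: "'m \<Rightarrow> 'm \<Rightarrow> 'm \<Rightarrow> bool"
  where "vertical_connection q \<iota> R \<longleftrightarrow>
    R \<in> hom X (TObj X (Dom X q)) (Dom X \<iota>) \<and>
    \<iota> \<Zsemi> R = Id X (Dom X \<iota>) \<and>
    linear_morphism (Id X (Dom X q)) R (tangent_bundle X (Dom X q)) (vertical_bundle q \<iota>)"

definition horizontal_connection :: "'m \<Rightarrow> 'm \<Rightarrow> 'm \<Rightarrow> 'm \<Rightarrow> bool"
  where "horizontal_connection q qF TF H \<longleftrightarrow>
    H \<in> hom X (Dom X qF) (TObj X (Dom X q)) \<and>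
    H \<Zsemi> horizontal_descent q qF TF = Id X (Dom X qF) \<and>
    linear_morphism (Id X (Dom X q)) H (finsler_bundle q qF TF) (tangent_bundle X (Dom X q))"

definition ehresmann_connection :: "'m \<Rightarrow> 'm \<Rightarrow> 'm \<Rightarrow> 'm \<Rightarrow> 'm \<Rightarrow> 'm \<Rightarrow> bool"
  where "ehresmann_connection q \<iota> qF TF R H \<longleftrightarrow>
    (let E = Dom X q in
      vertical_connection q \<iota> R \<and> horizontal_connection q qF TF H \<and>
      H \<Zsemi> R = qF \<Zsemi> bzero (vertical_bundle q \<iota>) \<and>
      pairing X (Tfst X E) (Tsnd X E) (R \<Zsemi> \<iota>) (horizontal_descent q qF TF \<Zsemi> H) \<Zsemi> Tadd X E
        = Id X (TObj X E))"

definition linear_ehresmann_connection ::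
    "'m bundle_data \<Rightarrow> 'm \<Rightarrow> 'm \<Rightarrow> 'm \<Rightarrow> 'm \<Rightarrow> 'm \<Rightarrow> 'm \<Rightarrow> bool"
  where "linear_ehresmann_connection q \<iota> TV qF TF R H \<longleftrightarrow>
    (let M = Cod X (bproj q) in
      ehresmann_connection (bproj q) \<iota> qF TF R H \<and>
      linear_morphism (Tproj X M) R (T_bundle X q) (TV_bundle q \<iota> TV) \<and>
      linear_morphism (Id X (TObj X M)) H (TF_bundle q qF TF) (T_bundle X q))"

definition vertical_koszul_connection :: "'m bundle_data \<Rightarrow> 'm \<Rightarrow> bool"
  where "vertical_koszul_connection q K \<longleftrightarrow>
    (let E = Dom X (bproj q); M = Cod X (bproj q) in
      K \<in> hom X (TObj X E) E \<and>
      blift q \<Zsemi> K = Id X E \<and>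
      linear_morphism (Tproj X M) K (T_bundle X q) q \<and>
      linear_morphism (bproj q) K (tangent_bundle X E) q)"

definition horizontal_koszul_connection :: "'m bundle_data \<Rightarrow> 'm \<Rightarrow> 'm \<Rightarrow> 'm \<Rightarrow> bool"
  where "horizontal_koszul_connection q qF TF H \<longleftrightarrow>
    (let E = Dom X (bproj q); M = Cod X (bproj q) in
      H \<in> hom X (Dom X qF) (TObj X E) \<and>
      H \<Zsemi> horizontal_descent (bproj q) qF TF = Id X (Dom X qF) \<and>
      linear_morphism (Id X E) H (finsler_bundle (bproj q) qF TF) (tangent_bundle X E) \<and>
      linear_morphism (Id X (TObj X M)) H (TF_bundle q qF TF) (T_bundle X q))"

definition koszul_connection :: "'m bundle_data \<Rightarrow> 'm \<Rightarrow> 'm \<Rightarrow> 'm \<Rightarrow> 'm \<Rightarrow> bool"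
  where "koszul_connection q qF TF K H \<longleftrightarrow>
    (let E = Dom X (bproj q) in
      vertical_koszul_connection q K \<and> horizontal_koszul_connection q qF TF H \<and>
      H \<Zsemi> K = qF \<Zsemi> bproj q \<Zsemi> bzero q \<and>
      pairing X (Tfst X E) (Tsnd X E)
        (pairing X (bfst q) (bsnd q) K (Tproj X E) \<Zsemi> xi X q)
        (horizontal_descent (bproj q) qF TF \<Zsemi> H) \<Zsemi> Tadd X E
        = Id X (TObj X E))"

end

end

theory Submission
  imports Defs
begin

text \<open>The lift \<open>l\<^sub>q\<close> is universal: \<open>\<xi>\<^sub>q: E\<^sub>2 \<rightarrow> TE\<close> is, just like \<open>\<iota>\<^sub>q\<close>, a pullback of \<open>Tq\<close> along
  \<open>z\<^sub>M\<close>, so the vertical bundle is a copy of \<open>E\<^sub>2\<close>. A morphism \<open>R: TE \<rightarrow> Vq\<close> over \<open>E\<close> is therefore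
  the same thing as a pair \<open>TE \<rightarrow> E\<^sub>2\<close> with second coordinate \<open>p\<^sub>E\<close>, and its first coordinate is
  the connector \<open>K = {R \<iota>\<^sub>q}\<^sub>q\<close>: one has \<open>R \<iota>\<^sub>q = \<langle>K, p\<^sub>E\<rangle> \<xi>\<^sub>q\<close> (lemma \<open>bracket_facts\<close>). The
  equation \<open>\<langle>R \<iota>\<^sub>q, \<pi>\<^sub>q H\<rangle> s\<^sub>E = id\<close> thus literally is its counterpart for \<open>K\<close>, and the conditions
  on \<open>H\<close> alone are common to both sides.

  Because \<open>\<xi>\<^sub>q\<close>, \<open>\<iota>\<^sub>q\<close> and their images under \<open>T\<close> are monic, the other equations for \<open>R\<close> can be
  compared with equations for \<open>K\<close> coordinate by coordinate in \<open>E\<^sub>2\<close>. The map \<open>\<xi>\<^sub>q\<close> intertwines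
  \<open>l\<^sub>E\<close> with \<open>\<langle>\<pi>\<^sub>1 l\<^sub>q, \<pi>\<^sub>2 z\<^sub>E\<rangle>\<close> and \<open>Tl\<^sub>q c\<^sub>E\<close> with \<open>\<langle>\<pi>\<^sub>1 l\<^sub>q, \<pi>\<^sub>2 l\<^sub>q\<rangle>\<close> (lemmas \<open>pair_xi_Tlift\<close> and
  \<open>pair_xi_T_lift_flip\<close>); the second coordinates always agree, and what remains in the first one
  is the corresponding linearity of \<open>K\<close>. In the same way, since \<open>z\<^sub>E = \<langle>q z\<^sub>q, id\<rangle> \<xi>\<^sub>q\<close>, the
  condition that \<open>H R\<close> vanishes becomes the condition that \<open>H K\<close> vanishes.

  The retraction laws are the one place where the translation is not coordinatewise. From
  \<open>l\<^sub>q = \<langle>id, q z\<^sub>q\<rangle> \<xi>\<^sub>q\<close> one gets \<open>\<iota>\<^sub>q R = id \<Longrightarrow> l\<^sub>q K = id\<close>. For the converse one needs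
  \<open>\<xi>\<^sub>q K = \<pi>\<^sub>1\<close> on all of \<open>E\<^sub>2\<close>, whereas \<open>l\<^sub>q K = id\<close> controls \<open>K\<close> on the first axis only. Since
  \<open>\<xi>\<^sub>q\<close> is the \<open>Ts\<^sub>q\<close>-sum of \<open>\<pi>\<^sub>1 l\<^sub>q\<close> and \<open>\<pi>\<^sub>2 z\<^sub>E\<close>, it suffices that \<open>K\<close> is additive, and this
  follows from its linearity: lemmas \<open>linear_imp_additive\<close> and \<open>linear_imp_preserves_zero\<close>.\<close>

section \<open>Typing and pullbacks\<close>

context category
begin

lemma hom_iff: "f \<in> hom C A B \<longleftrightarrow> f \<in> Arr C \<and> Dom C f = A \<and> Cod C f = B"
  by (simp add: hom_def)

lemma comp_typing [simp]:
  assumes "f \<in> Arr C" "g \<in> Arr C" "Cod C f = Dom C g"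
  shows "f \<Zsemi> g \<in> Arr C" "Dom C (f \<Zsemi> g) = Dom C f" "Cod C (f \<Zsemi> g) = Cod C g"
  using Comp_hom[of f "Dom C f" "Cod C f" g "Cod C g"] assms by (simp_all add: hom_iff)

lemma Id_typing [simp]:
  assumes "A \<in> Obj C"
  shows "Id C A \<in> Arr C" "Dom C (Id C A) = A" "Cod C (Id C A) = A"
  using Id_hom[OF assms] by (simp_all add: hom_iff)

lemma Obj_typing [simp]:
  assumes "f \<in> Arr C"
  shows "Dom C f \<in> Obj C" "Cod C f \<in> Obj C"
  using assms by (auto intro: Dom_Obj Cod_Obj)

lemma assoc [simp]:
  assumes "f \<in> Arr C" "g \<in> Arr C" "h \<in> Arr C" "Cod C f = Dom C g" "Cod C g = Dom C h"
  shows "(f \<Zsemi> g) \<Zsemi> h = f \<Zsemi> (g \<Zsemi> h)"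
  using Comp_assoc[of f _ _ g _ h] assms by (simp add: hom_iff)

lemma unit [simp]:
  assumes "f \<in> Arr C"
  shows "Dom C f = A \<Longrightarrow> Id C A \<Zsemi> f = f" "Cod C f = A \<Longrightarrow> f \<Zsemi> Id C A = f"
  using Id_left[of f] Id_right[of f] assms by (auto simp: hom_iff)

text \<open>With composites bracketed to the right, an equation between composites only rewrites
  at the end of a composite; this is the form that rewrites in the middle.\<close>

lemma then_comp:
  assumes "f \<Zsemi> g = h"
    and "f \<in> Arr C" "g \<in> Arr C" "k \<in> Arr C" "Cod C f = Dom C g" "Cod C g = Dom C k"
  shows "f \<Zsemi> (g \<Zsemi> k) = h \<Zsemi> k"
  using assms assoc by metis

lemma pullback_typing:
  assumes "pullback C a b f g"
  shows "a \<in> Arr C" "b \<in> Arr C" "f \<in> Arr C" "g \<in> Arr C" "Cod C a = Dom C f"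
    "Cod C b = Dom C g" "Dom C b = Dom C a" "Cod C g = Cod C f" "a \<Zsemi> f = b \<Zsemi> g"
  using assms by (auto simp: pullback_def hom_iff)

lemma pairing_into_pullback:
  assumes "pullback C a b f g"
    and "x \<in> Arr C" "y \<in> Arr C" "Dom C y = Dom C x" "Cod C x = Dom C f" "Cod C y = Dom C g"
    and "x \<Zsemi> f = y \<Zsemi> g"
  shows "pairing C a b x y \<in> Arr C" "Dom C (pairing C a b x y) = Dom C x"
    "Cod C (pairing C a b x y) = Dom C a"
    "pairing C a b x y \<Zsemi> a = x" "pairing C a b x y \<Zsemi> b = y"
proof -
  have "\<exists>!h. h \<in> hom C (Dom C x) (Dom C a) \<and> h \<Zsemi> a = x \<and> h \<Zsemi> b = y"
    using assms by (auto simp: pullback_def hom_iff)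
  from theI'[OF this]
  show "pairing C a b x y \<in> Arr C" "Dom C (pairing C a b x y) = Dom C x"
    "Cod C (pairing C a b x y) = Dom C a"
    "pairing C a b x y \<Zsemi> a = x" "pairing C a b x y \<Zsemi> b = y"
    by (simp_all add: pairing_def hom_iff)
qed

lemma pullback_jointly_monic:
  assumes pb: "pullback C a b f g"
    and h: "h \<in> Arr C" "Cod C h = Dom C a" and k: "k \<in> Arr C" "Cod C k = Dom C a"
    and "Dom C h = Dom C k" and "h \<Zsemi> a = k \<Zsemi> a" "h \<Zsemi> b = k \<Zsemi> b"
  shows "h = k"
proof -
  note [simp] = pullback_typing[OF pb]
  have "\<exists>!u. u \<in> hom C (Dom C h) (Dom C a) \<and> u \<Zsemi> a = h \<Zsemi> a \<and> u \<Zsemi> b = h \<Zsemi> b"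
    using pb[unfolded pullback_def, THEN conjunct2, THEN conjunct2, THEN conjunct2,
        THEN conjunct2, THEN conjunct2, THEN conjunct2, rule_format,
        of "h \<Zsemi> a" "Dom C h" "h \<Zsemi> b"] h by (simp add: hom_iff)
  then show ?thesis
    using assms by (auto simp: hom_iff)
qed

lemma pairing_eqI:
  assumes pb: "pullback C a b f g"
    and h: "h \<in> Arr C" "Cod C h = Dom C a" and "h \<Zsemi> a = x" "h \<Zsemi> b = y"
  shows "pairing C a b x y = h"
proof -
  note [simp] = pullback_typing[OF pb]
  have "pairing C a b (h \<Zsemi> a) (h \<Zsemi> b) = h"
    by (rule pullback_jointly_monic[OF pb]) (simp_all add: h pairing_into_pullback[OF pb])
  then show ?thesis using assms by simp
qed

lemma comp_pairing:
  assumes pb: "pullback C a b f g"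
    and "x \<in> Arr C" "y \<in> Arr C" "Dom C y = Dom C x" "Cod C x = Dom C f" "Cod C y = Dom C g"
    and "x \<Zsemi> f = y \<Zsemi> g" and "h \<in> Arr C" "Cod C h = Dom C x"
  shows "h \<Zsemi> pairing C a b x y = pairing C a b (h \<Zsemi> x) (h \<Zsemi> y)"
proof -
  note [simp] = pullback_typing[OF pb] pairing_into_pullback[OF pb] assms(2-)
  show ?thesis
    by (rule pairing_eqI[OF pb, symmetric]) simp_all
qed

text \<open>A morphism with a left inverse is monic, and monomorphisms are stable under pullback;
  for the pullbacks along zero sections this makes the first projection alone monic.\<close>

lemma pullback_of_split_mono_monic:
  assumes pb: "pullback C a b f g"
    and r: "r \<in> Arr C" "Dom C r = Cod C g" "g \<Zsemi> r = Id C (Dom C g)"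
    and h: "h \<in> Arr C" "Cod C h = Dom C a" and k: "k \<in> Arr C" "Cod C k = Dom C a"
    and dom: "Dom C h = Dom C k" and eq: "h \<Zsemi> a = k \<Zsemi> a"
  shows "h = k"
proof -
  note ty [simp] = pullback_typing[OF pb]
  have fac: "u \<Zsemi> b = (u \<Zsemi> a) \<Zsemi> (f \<Zsemi> r)" if "u \<in> Arr C" "Cod C u = Dom C a" for u
  proof -
    have "(a \<Zsemi> f) \<Zsemi> r = (b \<Zsemi> g) \<Zsemi> r" by (simp only: ty(9))
    then have "b = a \<Zsemi> (f \<Zsemi> r)" using r by (simp del: ty(9))
    then show ?thesis using that r by (metis ty assoc comp_typing)
  qed
  have "h \<Zsemi> b = k \<Zsemi> b" using fac[OF h] fac[OF k] eq by simp
  then show ?thesis using pullback_jointly_monic[OF pb h k dom eq] by simp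
qed

end


section \<open>Tangent categories in terms of generalised elements\<close>

context tangent_category
begin

lemma T_typing [simp]:
  assumes "f \<in> Arr X"
  shows "TArr X f \<in> Arr X" "Dom X (TArr X f) = TObj X (Dom X f)"
    "Cod X (TArr X f) = TObj X (Cod X f)"
  using TArr[of f] assms by (simp_all add: hom_iff)

lemma T_comp [simp]:
  assumes "f \<in> Arr X" "g \<in> Arr X" "Cod X f = Dom X g"
  shows "TArr X (f \<Zsemi> g) = TArr X f \<Zsemi> TArr X g"
  using TArr_Comp[of f _ _ g] assms by (simp add: hom_iff)

declare TObj [simp] TArr_Id [simp]

lemma structure_typing [simp]:
  assumes "A \<in> Obj X"
  shows "Tproj X A \<in> Arr X" "Dom X (Tproj X A) = TObj X A" "Cod X (Tproj X A) = A"
    "Tzero X A \<in> Arr X" "Dom X (Tzero X A) = A" "Cod X (Tzero X A) = TObj X A"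
    "Tlift X A \<in> Arr X" "Dom X (Tlift X A) = TObj X A"
    "Cod X (Tlift X A) = TObj X (TObj X A)"
    "Tflip X A \<in> Arr X" "Dom X (Tflip X A) = TObj X (TObj X A)"
    "Cod X (Tflip X A) = TObj X (TObj X A)"
    "Tadd X A \<in> Arr X" "Dom X (Tadd X A) = Dom X (Tfst X A)" "Cod X (Tadd X A) = TObj X A"
  using Tproj_hom[OF assms] Tzero_hom[OF assms] Tlift_hom[OF assms] Tflip_hom[OF assms]
    Tadd_hom[OF assms] by (simp_all add: hom_iff)

lemma naturality:
  assumes "f \<in> Arr X" "Dom X f = A" "Cod X f = B"
  shows "TArr X f \<Zsemi> Tproj X B = Tproj X A \<Zsemi> f"
    "f \<Zsemi> Tzero X B = Tzero X A \<Zsemi> TArr X f"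
    "TArr X f \<Zsemi> Tlift X B = Tlift X A \<Zsemi> TArr X (TArr X f)"
    "TArr X (TArr X f) \<Zsemi> Tflip X B = Tflip X A \<Zsemi> TArr X (TArr X f)"
  using Tproj_nat[of f A B] Tzero_nat[of f A B] Tlift_nat[of f A B] Tflip_nat[of f A B] assms
  by (simp_all add: hom_iff)

lemma tangent_pullback_iterate:
  assumes "tangent_pullback X a b f g"
  shows "pullback X a b f g" "pullback X (TArr X a) (TArr X b) (TArr X f) (TArr X g)"
    "pullback X (TArr X (TArr X a)) (TArr X (TArr X b)) (TArr X (TArr X f)) (TArr X (TArr X g))"
  using assms[unfolded tangent_pullback_def, rule_format, of 0]
    assms[unfolded tangent_pullback_def, rule_format, of "Suc 0"]
    assms[unfolded tangent_pullback_def, rule_format, of "Suc (Suc 0)"] by simp_all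

lemma T_pairing:
  assumes pb: "pullback X a b f g" and Tpb: "pullback X (TArr X a) (TArr X b) (TArr X f) (TArr X g)"
    and "x \<in> Arr X" "y \<in> Arr X" "Dom X y = Dom X x" "Cod X x = Dom X f" "Cod X y = Dom X g"
    and "x \<Zsemi> f = y \<Zsemi> g"
  shows "TArr X (pairing X a b x y) = pairing X (TArr X a) (TArr X b) (TArr X x) (TArr X y)"
proof -
  note [simp] = pullback_typing[OF pb] pairing_into_pullback[OF pb] assms(3-)
  show ?thesis
    by (rule pairing_eqI[OF Tpb, symmetric]) (simp_all flip: T_comp)
qed

lemma T2_pullback:
  assumes "A \<in> Obj X"
  shows "tangent_pullback X (Tfst X A) (Tsnd X A) (Tproj X A) (Tproj X A)"
  using T_powers[OF assms] by (simp add: has_tangent_fibre_powers_def tangent_bundle_def)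

lemma zero_section:
  assumes "A \<in> Obj X"
  shows "Tzero X A \<Zsemi> Tproj X A = Id X A"
  using T_additive[OF assms] assms
  by (simp add: additive_bundle_def tangent_bundle_def Let_def)

lemma zero_lift:
  assumes "A \<in> Obj X"
  shows "Tzero X A \<Zsemi> Tlift X A = Tzero X A \<Zsemi> TArr X (Tzero X A)"
  using Tlift_additive[OF assms]
  by (simp add: additive_bundle_morphism_def tangent_bundle_def T_bundle_def)

lemma lift_Tproj:
  assumes "A \<in> Obj X"
  shows "Tlift X A \<Zsemi> TArr X (Tproj X A) = Tproj X A \<Zsemi> Tzero X A"
  using Tlift_additive[OF assms]
  by (simp add: additive_bundle_morphism_def tangent_bundle_def T_bundle_def)

lemma flip_proj:
  assumes "A \<in> Obj X"
  shows "Tflip X A \<Zsemi> Tproj X (TObj X A) = TArr X (Tproj X A)"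
    "Tflip X A \<Zsemi> TArr X (Tproj X A) = Tproj X (TObj X A)"
proof -
  show 1: "Tflip X A \<Zsemi> Tproj X (TObj X A) = TArr X (Tproj X A)"
    using Tflip_additive[OF assms] assms
    by (simp add: additive_bundle_morphism_def tangent_bundle_def T_bundle_def)
  have "Tflip X A \<Zsemi> TArr X (Tproj X A) = (Tflip X A \<Zsemi> Tflip X A) \<Zsemi> Tproj X (TObj X A)"
    using assms by (simp add: 1)
  then show "Tflip X A \<Zsemi> TArr X (Tproj X A) = Tproj X (TObj X A)"
    using assms by (simp add: Tflip_Tflip)
qed

lemma flip_zero:
  assumes "A \<in> Obj X"
  shows "TArr X (Tzero X A) \<Zsemi> Tflip X A = Tzero X (TObj X A)"
    "Tzero X (TObj X A) \<Zsemi> Tflip X A = TArr X (Tzero X A)"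
proof -
  show 1: "TArr X (Tzero X A) \<Zsemi> Tflip X A = Tzero X (TObj X A)"
    using Tflip_additive[OF assms] assms
    by (simp add: additive_bundle_morphism_def tangent_bundle_def T_bundle_def)
  have "Tzero X (TObj X A) \<Zsemi> Tflip X A = TArr X (Tzero X A) \<Zsemi> (Tflip X A \<Zsemi> Tflip X A)"
    using assms by (simp flip: 1)
  then show "Tzero X (TObj X A) \<Zsemi> Tflip X A = TArr X (Tzero X A)"
    using assms by (simp add: Tflip_Tflip)
qed

text \<open>Additivity is stated through the generic pair of elements of a fibre, the two projections;
  precomposing with a pairing gives it for arbitrary generalised elements \<open>x\<close>, \<open>y\<close> of a fibre.\<close>

lemma additive_morphism_on_sums:
  assumes morph: "additive_bundle_morphism X f g b b'"
    and pb: "pullback X (bfst b) (bsnd b) (bproj b) (bproj b)"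
    and pb': "pullback X (bfst b') (bsnd b') (bproj b') (bproj b')"
    and s: "badd b \<in> Arr X" "Dom X (badd b) = Dom X (bfst b)" "Cod X (badd b) = Dom X (bproj b)"
    and s': "badd b' \<in> Arr X" "Dom X (badd b') = Dom X (bfst b')"
    and xy: "x \<in> Arr X" "y \<in> Arr X" "Dom X y = Dom X x" "Cod X x = Dom X (bproj b)"
      "Cod X y = Dom X (bproj b)" "x \<Zsemi> bproj b = y \<Zsemi> bproj b"
  shows "pairing X (bfst b) (bsnd b) x y \<Zsemi> (badd b \<Zsemi> g) =
    pairing X (bfst b') (bsnd b') (x \<Zsemi> g) (y \<Zsemi> g) \<Zsemi> badd b'"
proof -
  note ty = pullback_typing[OF pb] and ty' = pullback_typing[OF pb']
  have g: "g \<in> Arr X" "Dom X g = Dom X (bproj b)" "Cod X g = Dom X (bproj b')"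
    and f: "f \<in> Arr X" "Dom X f = Cod X (bproj b)"
    and sq: "g \<Zsemi> bproj b' = bproj b \<Zsemi> f"
    and add: "badd b \<Zsemi> g = pairing X (bfst b') (bsnd b') (bfst b \<Zsemi> g) (bsnd b \<Zsemi> g) \<Zsemi> badd b'"
    using morph by (simp_all add: additive_bundle_morphism_def hom_iff)
  note [simp] = g f ty(1-7) ty'(1-7) s s' xy(1-5) pairing_into_pullback[OF pb]
    pairing_into_pullback[OF pb'] xy(6)
  have eq: "u \<Zsemi> (g \<Zsemi> bproj b') = v \<Zsemi> (g \<Zsemi> bproj b')"
    if "u \<in> Arr X" "v \<in> Arr X" "Cod X u = Dom X (bproj b)" "Cod X v = Dom X (bproj b)"
      "u \<Zsemi> bproj b = v \<Zsemi> bproj b" for u v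
    using that then_comp[of u "bproj b" "v \<Zsemi> bproj b" f] by (simp add: sq)
  note [simp] = eq[OF _ _ _ _ ty(9)] eq[OF _ _ _ _ xy(6)]
  have "pairing X (bfst b) (bsnd b) x y \<Zsemi> (badd b \<Zsemi> g) =
    (pairing X (bfst b) (bsnd b) x y \<Zsemi> pairing X (bfst b') (bsnd b') (bfst b \<Zsemi> g) (bsnd b \<Zsemi> g))
      \<Zsemi> badd b'"
    by (simp add: add)
  also have "pairing X (bfst b) (bsnd b) x y
      \<Zsemi> pairing X (bfst b') (bsnd b') (bfst b \<Zsemi> g) (bsnd b \<Zsemi> g) =
    pairing X (bfst b') (bsnd b') (x \<Zsemi> g) (y \<Zsemi> g)"
    by (subst comp_pairing[OF pb'])
      (simp_all add: then_comp[OF pairing_into_pullback(4)[OF pb]]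
        then_comp[OF pairing_into_pullback(5)[OF pb]])
  finally show ?thesis .
qed

abbreviation tsum :: "'o \<Rightarrow> 'm \<Rightarrow> 'm \<Rightarrow> 'm"
  where "tsum A x y \<equiv> pairing X (Tfst X A) (Tsnd X A) x y \<Zsemi> Tadd X A"

lemma T2_typing [simp]:
  assumes "A \<in> Obj X"
  shows "Tfst X A \<in> Arr X" "Tsnd X A \<in> Arr X" "Cod X (Tfst X A) = TObj X A"
    "Cod X (Tsnd X A) = TObj X A" "Dom X (Tsnd X A) = Dom X (Tfst X A)"
  using pullback_typing[OF tangent_pullback_iterate(1)[OF T2_pullback[OF assms]]] assms
  by simp_all

lemma tsum_natural:
  assumes f: "f \<in> Arr X" "Dom X f = A" "Cod X f = B"
    and xy: "x \<in> Arr X" "y \<in> Arr X" "Dom X y = Dom X x" "Cod X x = TObj X A" "Cod X y = TObj X A"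
      "x \<Zsemi> Tproj X A = y \<Zsemi> Tproj X A"
  shows "pairing X (Tfst X A) (Tsnd X A) x y \<Zsemi> (Tadd X A \<Zsemi> TArr X f) =
    tsum B (x \<Zsemi> TArr X f) (y \<Zsemi> TArr X f)"
proof -
  have [simp]: "A \<in> Obj X" "B \<in> Obj X" using f by auto
  \<comment> \<open>naturality of \<open>p\<close>, \<open>z\<close>, \<open>s\<close> says exactly that \<open>Tf\<close> is an additive bundle morphism over \<open>f\<close>\<close>
  have "additive_bundle_morphism X f (TArr X f) (tangent_bundle X A) (tangent_bundle X B)"
    using f by (simp add: additive_bundle_morphism_def tangent_bundle_def hom_iff naturality
        Tadd_nat[of f A B])
  from additive_morphism_on_sums[OF this, of x y] show ?thesis
    using xy T2_pullback[of A] T2_pullback[of B] f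
    by (simp add: tangent_bundle_def tangent_pullback_iterate)
qed

lemma tsum_flip:
  assumes A [simp]: "A \<in> Obj X"
    and xy: "x \<in> Arr X" "y \<in> Arr X" "Dom X y = Dom X x" "Cod X x = TObj X (TObj X A)"
      "Cod X y = TObj X (TObj X A)" "x \<Zsemi> TArr X (Tproj X A) = y \<Zsemi> TArr X (Tproj X A)"
  shows "pairing X (TArr X (Tfst X A)) (TArr X (Tsnd X A)) x y \<Zsemi> (TArr X (Tadd X A) \<Zsemi> Tflip X A) =
    tsum (TObj X A) (x \<Zsemi> Tflip X A) (y \<Zsemi> Tflip X A)"
  using additive_morphism_on_sums[OF Tflip_additive[OF A], of x y] xy
    T2_pullback[of A] T2_pullback[of "TObj X A"]
  by (simp add: tangent_bundle_def T_bundle_def tangent_pullback_iterate)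

lemma additive_bundle_units:
  assumes b: "additive_bundle X b"
    and x: "x \<in> Arr X" "Cod X x = Dom X (bproj b)"
  shows "pairing X (bfst b) (bsnd b) (x \<Zsemi> (bproj b \<Zsemi> bzero b)) x \<Zsemi> badd b = x"
    "pairing X (bfst b) (bsnd b) x (x \<Zsemi> (bproj b \<Zsemi> bzero b)) \<Zsemi> badd b = x"
proof -
  have pb: "pullback X (bfst b) (bsnd b) (bproj b) (bproj b)"
    and z: "bzero b \<in> Arr X" "Dom X (bzero b) = Cod X (bproj b)"
      "Cod X (bzero b) = Dom X (bproj b)" "bzero b \<Zsemi> bproj b = Id X (Cod X (bproj b))"
    and s: "badd b \<in> Arr X" "Dom X (badd b) = Dom X (bfst b)"
    and unit: "pairing X (bfst b) (bsnd b) (bproj b \<Zsemi> bzero b) (Id X (Dom X (bproj b))) \<Zsemi> badd b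
      = Id X (Dom X (bproj b))"
    and comm: "pairing X (bfst b) (bsnd b) (bsnd b) (bfst b) \<Zsemi> badd b = badd b"
    using b by (simp_all add: additive_bundle_def Let_def hom_iff)
  note ty = pullback_typing[OF pb] and pair = pairing_into_pullback[OF pb]
  note [simp] = ty(1-7) x z s pair
  let ?u = "pairing X (bfst b) (bsnd b) (x \<Zsemi> (bproj b \<Zsemi> bzero b)) x"
  let ?v = "pairing X (bfst b) (bsnd b) x (x \<Zsemi> (bproj b \<Zsemi> bzero b))"
  have "?u = x \<Zsemi> pairing X (bfst b) (bsnd b) (bproj b \<Zsemi> bzero b) (Id X (Dom X (bproj b)))"
    by (subst comp_pairing[OF pb]) simp_all
  then have "?u \<Zsemi> badd b
      = x \<Zsemi> (pairing X (bfst b) (bsnd b) (bproj b \<Zsemi> bzero b) (Id X (Dom X (bproj b))) \<Zsemi> badd b)"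
    by simp
  then show u: "?u \<Zsemi> badd b = x" by (simp add: unit)
  have "?v = ?u \<Zsemi> pairing X (bfst b) (bsnd b) (bsnd b) (bfst b)"
    by (subst comp_pairing[OF pb]) (simp_all add: ty(9))
  then have "?v \<Zsemi> badd b = ?u \<Zsemi> (pairing X (bfst b) (bsnd b) (bsnd b) (bfst b) \<Zsemi> badd b)"
    by (simp add: ty(9))
  then show "?v \<Zsemi> badd b = x" by (simp add: comm u)
qed

end


section \<open>The map \<open>\<xi>\<close> of a differential bundle\<close>

locale diff_bundle = tangent_category X
  for X :: "('o, 'm) tangent_data" (structure) and q :: "'m bundle_data" +
  assumes diff: "differential_bundle X q"
begin

abbreviation "E \<equiv> Dom X (bproj q)"
abbreviation "M \<equiv> Cod X (bproj q)"
abbreviation "T \<equiv> TArr X"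

abbreviation pair :: "'m \<Rightarrow> 'm \<Rightarrow> 'm"
  where "pair \<equiv> pairing X (bfst q) (bsnd q)"

abbreviation Tpair :: "'m \<Rightarrow> 'm \<Rightarrow> 'm"
  where "Tpair \<equiv> pairing X (T (bfst q)) (T (bsnd q))"

abbreviation TTpair :: "'m \<Rightarrow> 'm \<Rightarrow> 'm"
  where "TTpair \<equiv> pairing X (T (T (bfst q))) (T (T (bsnd q)))"

lemma E2: "tangent_pullback X (bfst q) (bsnd q) (bproj q) (bproj q)"
  using diff by (simp add: differential_bundle_def has_tangent_fibre_powers_def Let_def)

lemmas E2_pullbacks = tangent_pullback_iterate[OF E2]

lemma additive: "additive_bundle X q"
  using diff by (simp add: differential_bundle_def Let_def)

lemma E2_typing [simp]:
  "bproj q \<in> Arr X" "bfst q \<in> Arr X" "bsnd q \<in> Arr X" "Cod X (bfst q) = E" "Cod X (bsnd q) = E"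
  "Dom X (bsnd q) = Dom X (bfst q)"
  using pullback_typing[OF E2_pullbacks(1)] by simp_all

lemma E2_square: "bfst q \<Zsemi> bproj q = bsnd q \<Zsemi> bproj q"
  using pullback_typing[OF E2_pullbacks(1)] by simp

lemma bundle_typing [simp]:
  "bzero q \<in> Arr X" "Dom X (bzero q) = M" "Cod X (bzero q) = E"
  "badd q \<in> Arr X" "Dom X (badd q) = Dom X (bfst q)" "Cod X (badd q) = E"
  "blift q \<in> Arr X" "Dom X (blift q) = E" "Cod X (blift q) = TObj X E"
  using additive diff
  by (simp_all add: differential_bundle_def additive_bundle_def Let_def hom_iff)

lemma bundle_laws:
  "bzero q \<Zsemi> bproj q = Id X M" "badd q \<Zsemi> bproj q = bfst q \<Zsemi> bproj q"
  "blift q \<Zsemi> Tlift X E = blift q \<Zsemi> T (blift q)"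
  using additive diff
  by (simp_all add: differential_bundle_def additive_bundle_def Let_def hom_iff)

lemma lift_additive_base:
  "additive_bundle_morphism X (Tzero X M) (blift q) q (T_bundle X q)"
  using diff by (simp add: differential_bundle_def Let_def)

lemma lift_additive_fibre:
  "additive_bundle_morphism X (bzero q) (blift q) q (tangent_bundle X E)"
  using diff by (simp add: differential_bundle_def Let_def)

lemma lift_laws:
  "blift q \<Zsemi> T (bproj q) = bproj q \<Zsemi> Tzero X M"
  "bzero q \<Zsemi> blift q = Tzero X M \<Zsemi> T (bzero q)"
  "blift q \<Zsemi> Tproj X E = bproj q \<Zsemi> bzero q"
  "bzero q \<Zsemi> blift q = bzero q \<Zsemi> Tzero X E"
  using lift_additive_base lift_additive_fibre
  by (simp_all add: additive_bundle_morphism_def T_bundle_def tangent_bundle_def)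

lemmas pair_simps = pairing_into_pullback[OF E2_pullbacks(1), simplified]
lemmas Tpair_simps = pairing_into_pullback[OF E2_pullbacks(2), simplified]
lemmas TTpair_simps = pairing_into_pullback[OF E2_pullbacks(3), simplified]
lemmas pairs_simps = pair_simps Tpair_simps TTpair_simps

lemma T_pair:
  assumes "x \<in> Arr X" "y \<in> Arr X" "Dom X y = Dom X x" "Cod X x = E" "Cod X y = E"
    "x \<Zsemi> bproj q = y \<Zsemi> bproj q"
  shows "T (pair x y) = Tpair (T x) (T y)"
  using T_pairing[OF E2_pullbacks(1,2)] assms by simp

lemma T_Tpair:
  assumes "x \<in> Arr X" "y \<in> Arr X" "Dom X y = Dom X x" "Cod X x = TObj X E" "Cod X y = TObj X E"
    "x \<Zsemi> T (bproj q) = y \<Zsemi> T (bproj q)"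
  shows "T (Tpair x y) = TTpair (T x) (T y)"
  using T_pairing[OF E2_pullbacks(2,3)] assms by simp

lemma T_zero_section: "T (bzero q) \<Zsemi> T (bproj q) = Id X (TObj X M)"
  by (simp add: bundle_laws flip: T_comp)

lemma T_additive_units:
  assumes x: "x \<in> Arr X" "Cod X x = TObj X E"
  shows "Tpair x (x \<Zsemi> (T (bproj q) \<Zsemi> T (bzero q))) \<Zsemi> T (badd q) = x"
proof -
  note [simp] = pairs_simps bundle_laws E2_square T_zero_section x
  have 1: "pair (Id X E) (bproj q \<Zsemi> bzero q) \<Zsemi> badd q = Id X E"
    using additive_bundle_units(2)[OF additive, of "Id X E"] by simp
  have "Tpair (Id X (TObj X E)) (T (bproj q) \<Zsemi> T (bzero q)) \<Zsemi> T (badd q)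
      = T (pair (Id X E) (bproj q \<Zsemi> bzero q) \<Zsemi> badd q)"
    by (simp add: T_pair)
  then have 2: "Tpair (Id X (TObj X E)) (T (bproj q) \<Zsemi> T (bzero q)) \<Zsemi> T (badd q)
      = Id X (TObj X E)"
    by (simp only: 1) simp
  have "x \<Zsemi> Tpair (Id X (TObj X E)) (T (bproj q) \<Zsemi> T (bzero q))
      = Tpair x (x \<Zsemi> (T (bproj q) \<Zsemi> T (bzero q)))"
    by (subst comp_pairing[OF E2_pullbacks(2)]) simp_all
  from then_comp[OF this, of "T (badd q)"] show ?thesis by (simp add: 2)
qed

lemma lift_sum_base:
  assumes "x \<in> Arr X" "y \<in> Arr X" "Dom X y = Dom X x" "Cod X x = E" "Cod X y = E"
    "x \<Zsemi> bproj q = y \<Zsemi> bproj q"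
  shows "pair x y \<Zsemi> (badd q \<Zsemi> blift q) = Tpair (x \<Zsemi> blift q) (y \<Zsemi> blift q) \<Zsemi> T (badd q)"
  using additive_morphism_on_sums[OF lift_additive_base, of x y] assms E2_pullbacks
  by (simp add: T_bundle_def)

lemma lift_sum_fibre:
  assumes "x \<in> Arr X" "y \<in> Arr X" "Dom X y = Dom X x" "Cod X x = E" "Cod X y = E"
    "x \<Zsemi> bproj q = y \<Zsemi> bproj q"
  shows "pair x y \<Zsemi> (badd q \<Zsemi> blift q) = tsum E (x \<Zsemi> blift q) (y \<Zsemi> blift q)"
  using additive_morphism_on_sums[OF lift_additive_fibre, of x y] assms E2_pullbacks
    T2_pullback[of E]
  by (simp add: tangent_bundle_def tangent_pullback_iterate)

lemma zero_T_proj: "Tzero X E \<Zsemi> T (bproj q) = bproj q \<Zsemi> Tzero X M"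
  by (simp add: naturality(2))

lemma pair_lift_zero:
  assumes "x \<in> Arr X" "y \<in> Arr X" "Dom X y = Dom X x" "Cod X x = E" "Cod X y = E"
    "x \<Zsemi> bproj q = y \<Zsemi> bproj q"
  shows "x \<Zsemi> (blift q \<Zsemi> T (bproj q)) = y \<Zsemi> (Tzero X E \<Zsemi> T (bproj q))"
    and "Tpair (x \<Zsemi> blift q) (y \<Zsemi> Tzero X E) \<in> Arr X"
    "Dom X (Tpair (x \<Zsemi> blift q) (y \<Zsemi> Tzero X E)) = Dom X x"
    "Cod X (Tpair (x \<Zsemi> blift q) (y \<Zsemi> Tzero X E)) = TObj X (Dom X (bfst q))"
    "Tpair (x \<Zsemi> blift q) (y \<Zsemi> Tzero X E) \<Zsemi> T (bfst q) = x \<Zsemi> blift q"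
    "Tpair (x \<Zsemi> blift q) (y \<Zsemi> Tzero X E) \<Zsemi> T (bsnd q) = y \<Zsemi> Tzero X E"
proof -
  show 1: "x \<Zsemi> (blift q \<Zsemi> T (bproj q)) = y \<Zsemi> (Tzero X E \<Zsemi> T (bproj q))"
    using assms then_comp[OF assms(6), of "Tzero X M"] by (simp add: lift_laws zero_T_proj)
  show "Tpair (x \<Zsemi> blift q) (y \<Zsemi> Tzero X E) \<in> Arr X"
    "Dom X (Tpair (x \<Zsemi> blift q) (y \<Zsemi> Tzero X E)) = Dom X x"
    "Cod X (Tpair (x \<Zsemi> blift q) (y \<Zsemi> Tzero X E)) = TObj X (Dom X (bfst q))"
    "Tpair (x \<Zsemi> blift q) (y \<Zsemi> Tzero X E) \<Zsemi> T (bfst q) = x \<Zsemi> blift q"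
    "Tpair (x \<Zsemi> blift q) (y \<Zsemi> Tzero X E) \<Zsemi> T (bsnd q) = y \<Zsemi> Tzero X E"
    using assms(1-5) 1 by (simp_all add: Tpair_simps)
qed

lemma pair_lifts:
  assumes "x \<in> Arr X" "y \<in> Arr X" "Dom X y = Dom X x" "Cod X x = E" "Cod X y = E"
    "x \<Zsemi> bproj q = y \<Zsemi> bproj q"
  shows "x \<Zsemi> (blift q \<Zsemi> T (bproj q)) = y \<Zsemi> (blift q \<Zsemi> T (bproj q))"
  using assms then_comp[OF assms(6), of "Tzero X M"] by (simp add: lift_laws)

lemma xi_typing [simp]:
  "xi X q \<in> Arr X" "Dom X (xi X q) = Dom X (bfst q)" "Cod X (xi X q) = TObj X E"
  by (simp_all add: xi_def pair_lift_zero E2_square)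

lemma pair_xi:
  assumes "x \<in> Arr X" "y \<in> Arr X" "Dom X y = Dom X x" "Cod X x = E" "Cod X y = E"
    "x \<Zsemi> bproj q = y \<Zsemi> bproj q"
  shows "pair x y \<Zsemi> xi X q = Tpair (x \<Zsemi> blift q) (y \<Zsemi> Tzero X E) \<Zsemi> T (badd q)"
proof -
  note [simp] = pair_simps pair_lift_zero(2-) assms
  have "pair x y \<Zsemi> Tpair (bfst q \<Zsemi> blift q) (bsnd q \<Zsemi> Tzero X E) =
      Tpair (x \<Zsemi> blift q) (y \<Zsemi> Tzero X E)"
    by (subst comp_pairing[OF E2_pullbacks(2)])
      (simp_all add: pair_lift_zero(1) E2_square pairs_simps(4)[THEN then_comp]
        pairs_simps(5)[THEN then_comp])
  then show ?thesis
    using then_comp[of "pair x y" "Tpair (bfst q \<Zsemi> blift q) (bsnd q \<Zsemi> Tzero X E)"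
        "Tpair (x \<Zsemi> blift q) (y \<Zsemi> Tzero X E)" "T (badd q)"]
    by (simp add: xi_def E2_square)
qed

lemma xi_pullback: "tangent_pullback X (xi X q) (bfst q \<Zsemi> bproj q) (T (bproj q)) (Tzero X M)"
  using diff by (simp add: differential_bundle_def universal_lift_def Let_def)

lemma xi_monic:
  assumes "h \<in> Arr X" "k \<in> Arr X" "Cod X h = Dom X (bfst q)" "Cod X k = Dom X (bfst q)"
    "Dom X h = Dom X k" "h \<Zsemi> xi X q = k \<Zsemi> xi X q"
  shows "h = k"
  by (rule pullback_of_split_mono_monic[OF tangent_pullback_iterate(1)[OF xi_pullback],
      where r = "Tproj X M"]) (use assms in \<open>simp_all add: zero_section\<close>)

lemma T_xi_monic:
  assumes "h \<in> Arr X" "k \<in> Arr X" "Cod X h = TObj X (Dom X (bfst q))"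
    "Cod X k = TObj X (Dom X (bfst q))"
    "Dom X h = Dom X k" "h \<Zsemi> T (xi X q) = k \<Zsemi> T (xi X q)"
  shows "h = k"
  by (rule pullback_of_split_mono_monic[OF tangent_pullback_iterate(2)[OF xi_pullback],
      where r = "T (Tproj X M)"]) (use assms in \<open>simp_all add: zero_section flip: T_comp\<close>)

text \<open>The second coordinate of an element of \<open>E\<^sub>2\<close> is the base point of the vertical vector that
  \<open>\<xi>\<^sub>q\<close> makes of it: \<open>p\<close> sends \<open>l\<^sub>q\<close> to zero and \<open>z\<^sub>E\<close> to the identity, so only the unit law of
  \<open>s\<^sub>q\<close> is left.\<close>

lemma pair_xi_proj:
  assumes "x \<in> Arr X" "y \<in> Arr X" "Dom X y = Dom X x" "Cod X x = E" "Cod X y = E"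
    "x \<Zsemi> bproj q = y \<Zsemi> bproj q"
  shows "pair x y \<Zsemi> (xi X q \<Zsemi> Tproj X E) = y"
proof -
  let ?u = "Tpair (x \<Zsemi> blift q) (y \<Zsemi> Tzero X E)"
  note [simp] = pair_simps assms and u [simp] = pair_lift_zero(2-)[OF assms]
  have "?u \<Zsemi> Tproj X (Dom X (bfst q)) = pair (x \<Zsemi> (bproj q \<Zsemi> bzero q)) y"
    by (rule pairing_eqI[OF E2_pullbacks(1), symmetric])
      (simp_all add: lift_laws zero_section u(4,5)[THEN then_comp] flip: naturality(1))
  moreover have "pair x y \<Zsemi> (xi X q \<Zsemi> Tproj X E) = ?u \<Zsemi> (T (badd q) \<Zsemi> Tproj X E)"
    using then_comp[OF pair_xi[of x y], of "Tproj X E"] by simp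
  moreover have "?u \<Zsemi> (T (badd q) \<Zsemi> Tproj X E) = (?u \<Zsemi> Tproj X (Dom X (bfst q))) \<Zsemi> badd q"
    by (simp add: naturality(1)[of "badd q"])
  ultimately have "pair x y \<Zsemi> (xi X q \<Zsemi> Tproj X E) = pair (y \<Zsemi> (bproj q \<Zsemi> bzero q)) y \<Zsemi> badd q"
    using then_comp[of x "bproj q" "y \<Zsemi> bproj q" "bzero q"] by simp
  also have "\<dots> = y"
    using additive_bundle_units(1)[OF additive, of y] by simp
  finally show ?thesis .
qed

lemma zero_zero: "bzero q \<Zsemi> Tzero X E = Tzero X M \<Zsemi> T (bzero q)"
  by (simp add: naturality)

text \<open>The restriction of \<open>\<xi>\<^sub>q\<close> to the first axis is the lift. The summand \<open>z\<^sub>E\<close> at a zero vector is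
  the zero of the bundle \<open>Tq\<close>, so the unit law of \<open>Ts\<^sub>q\<close> removes it.\<close>

lemma pair_xi_lift:
  assumes "x \<in> Arr X" "Cod X x = E"
  shows "pair x (x \<Zsemi> (bproj q \<Zsemi> bzero q)) \<Zsemi> xi X q = x \<Zsemi> blift q"
proof -
  have "bproj q \<Zsemi> (bzero q \<Zsemi> Tzero X E) = blift q \<Zsemi> (T (bproj q) \<Zsemi> T (bzero q))"
    by (simp add: lift_laws(1)[THEN then_comp] zero_zero)
  then show ?thesis
    using T_additive_units[of "x \<Zsemi> blift q"] assms by (simp add: pair_xi bundle_laws)
qed

text \<open>The restriction of \<open>\<xi>\<^sub>q\<close> to the second axis is the zero section of \<open>TE\<close>, by naturality of \<open>z\<close>
  with respect to \<open>s\<^sub>q\<close>: on zero vectors \<open>l\<^sub>q\<close> and \<open>z\<^sub>E\<close> coincide.\<close>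

lemma pair_xi_zero:
  assumes "x \<in> Arr X" "Cod X x = E"
  shows "pair (x \<Zsemi> (bproj q \<Zsemi> bzero q)) x \<Zsemi> xi X q = x \<Zsemi> Tzero X E"
proof -
  note [simp] = pair_simps bundle_laws assms
  let ?u = "pair (bproj q \<Zsemi> bzero q) (Id X E)"
  have 1: "?u \<Zsemi> badd q = Id X E"
    using additive_bundle_units(1)[OF additive, of "Id X E"] by simp
  have "Tzero X E = ?u \<Zsemi> (badd q \<Zsemi> Tzero X E)"
    by (simp add: 1[THEN then_comp])
  also have "\<dots> = (?u \<Zsemi> Tzero X (Dom X (bfst q))) \<Zsemi> T (badd q)"
    by (simp add: naturality(2)[of "badd q"])
  also have "?u \<Zsemi> Tzero X (Dom X (bfst q)) = Tpair (bproj q \<Zsemi> (bzero q \<Zsemi> blift q)) (Tzero X E)"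
    by (rule pairing_eqI[OF E2_pullbacks(2), symmetric])
      (simp_all add: naturality(2)[symmetric] lift_laws(4) pair_simps(4,5)[THEN then_comp])
  finally have "x \<Zsemi> Tzero X E
      = x \<Zsemi> (Tpair (bproj q \<Zsemi> (bzero q \<Zsemi> blift q)) (Tzero X E) \<Zsemi> T (badd q))"
    by simp
  also have "\<dots> = x \<Zsemi> (pair (bproj q \<Zsemi> bzero q) (Id X E) \<Zsemi> xi X q)"
    by (simp add: pair_xi)
  also have "\<dots> = (x \<Zsemi> pair (bproj q \<Zsemi> bzero q) (Id X E)) \<Zsemi> xi X q"
    by simp
  also have "x \<Zsemi> pair (bproj q \<Zsemi> bzero q) (Id X E) = pair (x \<Zsemi> (bproj q \<Zsemi> bzero q)) x"
    by (subst comp_pairing[OF E2_pullbacks(1)]) simp_all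
  finally show ?thesis by simp
qed

lemma T_pair_lift_zero:
  assumes "x \<in> Arr X" "y \<in> Arr X" "Dom X y = Dom X x" "Cod X x = TObj X E" "Cod X y = TObj X E"
    "x \<Zsemi> T (bproj q) = y \<Zsemi> T (bproj q)"
  shows "x \<Zsemi> (T (blift q) \<Zsemi> T (T (bproj q))) = y \<Zsemi> (T (Tzero X E) \<Zsemi> T (T (bproj q)))"
    "x \<Zsemi> (T (blift q) \<Zsemi> T (T (bproj q))) = y \<Zsemi> (T (blift q) \<Zsemi> T (T (bproj q)))"
proof -
  have 1: "T (blift q) \<Zsemi> T (T (bproj q)) = T (bproj q) \<Zsemi> T (Tzero X M)"
    using arg_cong[OF lift_laws(1), of T] by simp
  have 2: "T (Tzero X E) \<Zsemi> T (T (bproj q)) = T (bproj q) \<Zsemi> T (Tzero X M)"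
    using arg_cong[OF zero_T_proj, of T] by simp
  show "x \<Zsemi> (T (blift q) \<Zsemi> T (T (bproj q))) = y \<Zsemi> (T (Tzero X E) \<Zsemi> T (T (bproj q)))"
    "x \<Zsemi> (T (blift q) \<Zsemi> T (T (bproj q))) = y \<Zsemi> (T (blift q) \<Zsemi> T (T (bproj q)))"
    using then_comp[OF assms(6), of "T (Tzero X M)"] assms(1-5) by (simp_all add: 1 2)
qed

lemma T_E2_square: "T (bfst q) \<Zsemi> T (bproj q) = T (bsnd q) \<Zsemi> T (bproj q)"
  using arg_cong[OF E2_square, of T] by simp

lemma Tpair_T_xi:
  assumes "x \<in> Arr X" "y \<in> Arr X" "Dom X y = Dom X x" "Cod X x = TObj X E" "Cod X y = TObj X E"
    "x \<Zsemi> T (bproj q) = y \<Zsemi> T (bproj q)"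
  shows "Tpair x y \<Zsemi> T (xi X q) = TTpair (x \<Zsemi> T (blift q)) (y \<Zsemi> T (Tzero X E)) \<Zsemi> T (T (badd q))"
proof -
  note [simp] = Tpair_simps TTpair_simps T_pair_lift_zero(1) T_E2_square assms
  have xi: "T (xi X q) =
      TTpair (T (bfst q) \<Zsemi> T (blift q)) (T (bsnd q) \<Zsemi> T (Tzero X E)) \<Zsemi> T (T (badd q))"
    by (simp add: xi_def E2_square pair_lift_zero T_Tpair)
  have "Tpair x y \<Zsemi> TTpair (T (bfst q) \<Zsemi> T (blift q)) (T (bsnd q) \<Zsemi> T (Tzero X E)) =
      TTpair (x \<Zsemi> T (blift q)) (y \<Zsemi> T (Tzero X E))"
    by (subst comp_pairing[OF E2_pullbacks(3)]) (simp_all add: Tpair_simps(4,5)[THEN then_comp])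
  from then_comp[OF this, of "T (T (badd q))"] show ?thesis
    by (simp add: xi)
qed

lemma T_lift_sum_base:
  assumes "x \<in> Arr X" "y \<in> Arr X" "Dom X y = Dom X x" "Cod X x = TObj X E" "Cod X y = TObj X E"
    "x \<Zsemi> T (bproj q) = y \<Zsemi> T (bproj q)"
  shows "Tpair x y \<Zsemi> (T (badd q) \<Zsemi> T (blift q)) =
    TTpair (x \<Zsemi> T (blift q)) (y \<Zsemi> T (blift q)) \<Zsemi> T (T (badd q))"
proof -
  note [simp] = pairs_simps T_pair_lift_zero(2) T_E2_square E2_square pair_lifts assms
  have id: "pair (bfst q) (bsnd q) = Id X (Dom X (bfst q))"
    by (rule pairing_eqI[OF E2_pullbacks(1)]) simp_all
  have "badd q \<Zsemi> blift q = Tpair (bfst q \<Zsemi> blift q) (bsnd q \<Zsemi> blift q) \<Zsemi> T (badd q)"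
    using lift_sum_base[of "bfst q" "bsnd q"] by (simp add: id)
  from arg_cong[OF this, of T] have sl: "T (badd q) \<Zsemi> T (blift q) =
      TTpair (T (bfst q) \<Zsemi> T (blift q)) (T (bsnd q) \<Zsemi> T (blift q)) \<Zsemi> T (T (badd q))"
    by (simp add: T_Tpair)
  have "Tpair x y \<Zsemi> TTpair (T (bfst q) \<Zsemi> T (blift q)) (T (bsnd q) \<Zsemi> T (blift q)) =
      TTpair (x \<Zsemi> T (blift q)) (y \<Zsemi> T (blift q))"
    by (subst comp_pairing[OF E2_pullbacks(3)]) (simp_all add: Tpair_simps(4,5)[THEN then_comp])
  from then_comp[OF this, of "T (T (badd q))"] show ?thesis
    by (simp add: sl)
qed

lemma T_sum_lift:
  assumes "x \<in> Arr X" "y \<in> Arr X" "Dom X y = Dom X x" "Cod X x = TObj X E" "Cod X y = TObj X E"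
    "x \<Zsemi> T (bproj q) = y \<Zsemi> T (bproj q)"
  shows "Tpair x y \<Zsemi> (T (badd q) \<Zsemi> Tlift X E) =
    TTpair (x \<Zsemi> Tlift X E) (y \<Zsemi> Tlift X E) \<Zsemi> T (T (badd q))"
proof -
  note [simp] = Tpair_simps TTpair_simps assms
  have "TTpair (x \<Zsemi> Tlift X E) (y \<Zsemi> Tlift X E) = Tpair x y \<Zsemi> Tlift X (Dom X (bfst q))"
    by (rule pairing_eqI[OF E2_pullbacks(3)])
      (simp_all add: naturality(3)[symmetric] Tpair_simps(4,5)[THEN then_comp])
  then show ?thesis by (simp add: naturality(3)[of "badd q"])
qed

lemma TT_sum_flip:
  assumes "x \<in> Arr X" "y \<in> Arr X" "Dom X y = Dom X x" "Cod X x = TObj X (TObj X E)"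
    "Cod X y = TObj X (TObj X E)" "x \<Zsemi> T (T (bproj q)) = y \<Zsemi> T (T (bproj q))"
  shows "TTpair x y \<Zsemi> (T (T (badd q)) \<Zsemi> Tflip X E) =
    TTpair (x \<Zsemi> Tflip X E) (y \<Zsemi> Tflip X E) \<Zsemi> T (T (badd q))"
proof -
  note [simp] = TTpair_simps assms
  have "TTpair (x \<Zsemi> Tflip X E) (y \<Zsemi> Tflip X E) = TTpair x y \<Zsemi> Tflip X (Dom X (bfst q))"
    by (rule pairing_eqI[OF E2_pullbacks(3)])
      (simp_all add: naturality(4)[symmetric] TTpair_simps(4,5)[THEN then_comp])
  then show ?thesis by (simp add: naturality(4)[of "badd q"])
qed

text \<open>Linearity of \<open>\<xi>\<^sub>q\<close> with respect to the lift of \<open>Tq\<close>. Additivity of \<open>l\<^sub>q\<close> moves \<open>Tl\<^sub>q\<close> inside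
  the sum \<open>Ts\<^sub>q\<close>, and then \<open>l\<^sub>q Tl\<^sub>q c\<^sub>E = l\<^sub>q Tl\<^sub>q\<close> and \<open>z\<^sub>E Tl\<^sub>q c\<^sub>E = l\<^sub>q Tz\<^sub>E\<close> identify the summands.\<close>

lemma pair_xi_T_lift_flip:
  assumes "x \<in> Arr X" "y \<in> Arr X" "Dom X y = Dom X x" "Cod X x = E" "Cod X y = E"
    "x \<Zsemi> bproj q = y \<Zsemi> bproj q"
  shows "pair x y \<Zsemi> (xi X q \<Zsemi> (T (blift q) \<Zsemi> Tflip X E)) =
    Tpair (x \<Zsemi> blift q) (y \<Zsemi> blift q) \<Zsemi> T (xi X q)"
proof -
  note [simp] = assms pair_simps pair_lift_zero[OF assms] pair_lifts[OF assms]
  have par: "x \<Zsemi> (blift q \<Zsemi> (T (blift q) \<Zsemi> T (T (bproj q)))) =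
      y \<Zsemi> (Tzero X E \<Zsemi> (T (blift q) \<Zsemi> T (T (bproj q))))"
    using T_pair_lift_zero(2)[of "x \<Zsemi> blift q" "y \<Zsemi> Tzero X E"] by simp
  let ?u = "Tpair (x \<Zsemi> blift q) (y \<Zsemi> Tzero X E)"
  have l: "blift q \<Zsemi> (T (blift q) \<Zsemi> Tflip X E) = blift q \<Zsemi> T (blift q)"
    using then_comp[OF bundle_laws(3), of "Tflip X E"] by (simp add: Tlift_Tflip bundle_laws(3))
  have z: "Tzero X E \<Zsemi> (T (blift q) \<Zsemi> Tflip X E) = blift q \<Zsemi> T (Tzero X E)"
    by (simp add: then_comp[OF naturality(2)[symmetric]] flip_zero)
  have "pair x y \<Zsemi> (xi X q \<Zsemi> (T (blift q) \<Zsemi> Tflip X E)) =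
      ?u \<Zsemi> (T (badd q) \<Zsemi> (T (blift q) \<Zsemi> Tflip X E))"
    using then_comp[OF pair_xi[OF assms], of "T (blift q) \<Zsemi> Tflip X E"] by simp
  also have "\<dots> = (?u \<Zsemi> (T (badd q) \<Zsemi> T (blift q))) \<Zsemi> Tflip X E"
    by simp
  also have "?u \<Zsemi> (T (badd q) \<Zsemi> T (blift q)) =
      TTpair (x \<Zsemi> (blift q \<Zsemi> T (blift q))) (y \<Zsemi> (Tzero X E \<Zsemi> T (blift q))) \<Zsemi> T (T (badd q))"
    by (subst T_lift_sum_base) simp_all
  also have "\<dots> \<Zsemi> Tflip X E =
      TTpair (x \<Zsemi> (blift q \<Zsemi> T (blift q))) (y \<Zsemi> (blift q \<Zsemi> T (Tzero X E))) \<Zsemi> T (T (badd q))"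
    using TT_sum_flip[of "x \<Zsemi> (blift q \<Zsemi> T (blift q))" "y \<Zsemi> (Tzero X E \<Zsemi> T (blift q))"]
    by (simp add: par l z TTpair_simps)
  also have "\<dots> = Tpair (x \<Zsemi> blift q) (y \<Zsemi> blift q) \<Zsemi> T (xi X q)"
    using pair_lifts[OF assms] by (subst Tpair_T_xi) simp_all
  finally show ?thesis .
qed

text \<open>Linearity of \<open>\<xi>\<^sub>q\<close> with respect to the lift of \<open>TE\<close>: naturality of \<open>l\<close> for \<open>s\<^sub>q\<close> reduces it to
  \<open>l\<^sub>q l\<^sub>E = l\<^sub>q Tl\<^sub>q\<close> and \<open>z\<^sub>E l\<^sub>E = z\<^sub>E Tz\<^sub>E\<close>.\<close>

lemma pair_xi_Tlift:
  assumes "x \<in> Arr X" "y \<in> Arr X" "Dom X y = Dom X x" "Cod X x = E" "Cod X y = E"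
    "x \<Zsemi> bproj q = y \<Zsemi> bproj q"
  shows "pair x y \<Zsemi> (xi X q \<Zsemi> Tlift X E) =
    Tpair (x \<Zsemi> blift q) (y \<Zsemi> Tzero X E) \<Zsemi> T (xi X q)"
proof -
  note [simp] = assms pair_simps pair_lift_zero[OF assms]
  let ?u = "Tpair (x \<Zsemi> blift q) (y \<Zsemi> Tzero X E)"
  have "pair x y \<Zsemi> (xi X q \<Zsemi> Tlift X E) = ?u \<Zsemi> (T (badd q) \<Zsemi> Tlift X E)"
    using then_comp[OF pair_xi[OF assms], of "Tlift X E"] by simp
  also have "\<dots> = TTpair (x \<Zsemi> (blift q \<Zsemi> Tlift X E)) (y \<Zsemi> (Tzero X E \<Zsemi> Tlift X E)) \<Zsemi> T (T (badd q))"
    by (subst T_sum_lift) simp_all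
  also have "\<dots> = ?u \<Zsemi> T (xi X q)"
    by (subst Tpair_T_xi) (simp_all add: bundle_laws zero_lift)
  finally show ?thesis .
qed

text \<open>A linear morphism is additive. After composition with the monic \<open>l\<^sub>q\<close>, the sum \<open>s\<^sub>q\<close> becomes the
  sum of tangent vectors of \<open>E\<close>, and every \<open>TK\<close> preserves those by naturality; linearity of \<open>K\<close>
  is what trades \<open>K l\<^sub>q\<close> for a composite ending in \<open>TK\<close>. Here \<open>l\<^sub>q\<close> is monic because \<open>K\<close> retracts
  it.\<close>

lemma linear_imp_additive:
  assumes K [simp]: "K \<in> Arr X" "Dom X K = TObj X E" "Cod X K = E"
    and retr: "blift q \<Zsemi> K = Id X E"
    and over: "K \<Zsemi> bproj q = T (bproj q) \<Zsemi> Tproj X M"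
    and lin: "K \<Zsemi> blift q = T (blift q) \<Zsemi> (Tflip X E \<Zsemi> T K)"
    and xy [simp]: "x \<in> Arr X" "y \<in> Arr X" "Dom X y = Dom X x" "Cod X x = TObj X E"
      "Cod X y = TObj X E"
    and fib: "x \<Zsemi> T (bproj q) = y \<Zsemi> T (bproj q)"
  shows "Tpair x y \<Zsemi> (T (badd q) \<Zsemi> K) = pair (x \<Zsemi> K) (y \<Zsemi> K) \<Zsemi> badd q"
proof -
  let ?TT2 = "pairing X (T (Tfst X E)) (T (Tsnd X E))"
  note TE2 = tangent_pullback_iterate[OF T2_pullback[of E]]
  note TTE2 = tangent_pullback_iterate(1)[OF T2_pullback[of "TObj X E"]]
  note T2_simps = pairing_into_pullback[OF TE2(1)] pairing_into_pullback[OF TE2(2)]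
  have base: "(x \<Zsemi> K) \<Zsemi> bproj q = (y \<Zsemi> K) \<Zsemi> bproj q"
    using then_comp[OF fib, of "Tproj X M"] by (simp add: over)
  have lp: "T (blift q) \<Zsemi> T (Tproj X E) = T (bproj q) \<Zsemi> T (bzero q)"
    using arg_cong[OF lift_laws(3), of T] by simp
  have par: "x \<Zsemi> (T (bproj q) \<Zsemi> T (bzero q)) = y \<Zsemi> (T (bproj q) \<Zsemi> T (bzero q))"
    using then_comp[OF fib, of "T (bzero q)"] by simp
  note [simp] = pair_simps Tpair_simps T2_simps E2_square T_E2_square fib lift_laws(3) lp par
    E2_square[THEN then_comp] T_E2_square[THEN then_comp]
  have id: "pair (bfst q) (bsnd q) = Id X (Dom X (bfst q))"
    by (rule pairing_eqI[OF E2_pullbacks(1)]) simp_all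
  have "badd q \<Zsemi> blift q = tsum E (bfst q \<Zsemi> blift q) (bsnd q \<Zsemi> blift q)"
    using lift_sum_fibre[of "bfst q" "bsnd q"] by (simp add: id)
  from arg_cong[OF this, of T] have sl: "T (badd q) \<Zsemi> T (blift q) =
      ?TT2 (T (bfst q) \<Zsemi> T (blift q)) (T (bsnd q) \<Zsemi> T (blift q)) \<Zsemi> T (Tadd X E)"
    by (simp add: T_pairing[OF TE2(1,2)])
  have 1: "Tpair x y \<Zsemi> ?TT2 (T (bfst q) \<Zsemi> T (blift q)) (T (bsnd q) \<Zsemi> T (blift q)) =
      ?TT2 (x \<Zsemi> T (blift q)) (y \<Zsemi> T (blift q))"
    by (subst comp_pairing[OF TE2(2)]) (simp_all add: Tpair_simps(4,5)[THEN then_comp])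
  have "(Tpair x y \<Zsemi> (T (badd q) \<Zsemi> K)) \<Zsemi> blift q =
      Tpair x y \<Zsemi> ((T (badd q) \<Zsemi> T (blift q)) \<Zsemi> (Tflip X E \<Zsemi> T K))"
    by (simp add: lin)
  also have "\<dots> = ?TT2 (x \<Zsemi> T (blift q)) (y \<Zsemi> T (blift q)) \<Zsemi> (T (Tadd X E) \<Zsemi> Tflip X E) \<Zsemi> T K"
    using then_comp[OF 1, of "T (Tadd X E) \<Zsemi> (Tflip X E \<Zsemi> T K)"] by (simp add: sl)
  also have "\<dots> = tsum (TObj X E) (x \<Zsemi> (T (blift q) \<Zsemi> Tflip X E)) (y \<Zsemi> (T (blift q) \<Zsemi> Tflip X E))
      \<Zsemi> T K"
    by (subst tsum_flip) simp_all
  also have "\<dots> = tsum E (x \<Zsemi> (T (blift q) \<Zsemi> (Tflip X E \<Zsemi> T K)))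
      (y \<Zsemi> (T (blift q) \<Zsemi> (Tflip X E \<Zsemi> T K)))"
    using tsum_natural[of K "TObj X E" E "x \<Zsemi> (T (blift q) \<Zsemi> Tflip X E)"
        "y \<Zsemi> (T (blift q) \<Zsemi> Tflip X E)"]
    by (simp add: flip_proj pairing_into_pullback[OF TTE2])
  also have "\<dots> = tsum E ((x \<Zsemi> K) \<Zsemi> blift q) ((y \<Zsemi> K) \<Zsemi> blift q)"
    by (simp add: lin)
  also have "\<dots> = pair (x \<Zsemi> K) (y \<Zsemi> K) \<Zsemi> (badd q \<Zsemi> blift q)"
    by (rule lift_sum_fibre[symmetric]) (simp_all only: base, simp_all)
  finally have "((Tpair x y \<Zsemi> (T (badd q) \<Zsemi> K)) \<Zsemi> blift q) \<Zsemi> K =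
      (pair (x \<Zsemi> K) (y \<Zsemi> K) \<Zsemi> (badd q \<Zsemi> blift q)) \<Zsemi> K"
    by (rule arg_cong)
  moreover have "x \<Zsemi> (K \<Zsemi> bproj q) = y \<Zsemi> (K \<Zsemi> bproj q)"
    using base by simp
  ultimately show ?thesis by (simp add: retr)
qed

text \<open>Projecting \<open>K l\<^sub>q = l\<^sub>E TK\<close> to \<open>E\<close> turns both lifts into zeros.\<close>

lemma linear_imp_preserves_zero:
  assumes K [simp]: "K \<in> Arr X" "Dom X K = TObj X E" "Cod X K = E"
    and over: "K \<Zsemi> bproj q = Tproj X E \<Zsemi> bproj q"
    and lin: "K \<Zsemi> blift q = Tlift X E \<Zsemi> T K"
  shows "Tzero X E \<Zsemi> K = bproj q \<Zsemi> bzero q"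
proof -
  have lp: "Tlift X E \<Zsemi> Tproj X (TObj X E) = Tproj X E \<Zsemi> Tzero X E"
    by (subst Tlift_Tflip[of E, symmetric]) (simp_all add: flip_proj lift_Tproj)
  have "Tproj X E \<Zsemi> (Tzero X E \<Zsemi> K) = Tlift X E \<Zsemi> (Tproj X (TObj X E) \<Zsemi> K)"
    by (simp add: lp[THEN then_comp])
  also have "\<dots> = (K \<Zsemi> blift q) \<Zsemi> Tproj X E"
    by (simp add: lin naturality(1)[of K])
  also have "\<dots> = Tproj X E \<Zsemi> (bproj q \<Zsemi> bzero q)"
    by (simp add: lift_laws(3) over[THEN then_comp])
  \<comment> \<open>\<open>z\<^sub>E\<close> in front cancels the projection, which it splits\<close>
  finally have "Tzero X E \<Zsemi> (Tproj X E \<Zsemi> (Tzero X E \<Zsemi> K)) =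
      Tzero X E \<Zsemi> (Tproj X E \<Zsemi> (bproj q \<Zsemi> bzero q))"
    by simp
  then show ?thesis by (simp add: zero_section[THEN then_comp])
qed

text \<open>\<open>\<xi>\<^sub>q K = \<pi>\<^sub>1\<close>: by additivity \<open>K\<close> sends the two summands of \<open>\<xi>\<^sub>q\<close> to \<open>\<pi>\<^sub>1\<close> and to zero.\<close>

lemma pair_xi_connector:
  assumes K [simp]: "K \<in> Arr X" "Dom X K = TObj X E" "Cod X K = E"
    and retr: "blift q \<Zsemi> K = Id X E"
    and over: "K \<Zsemi> bproj q = T (bproj q) \<Zsemi> Tproj X M"
    and lin: "K \<Zsemi> blift q = T (blift q) \<Zsemi> (Tflip X E \<Zsemi> T K)"
    and lin': "K \<Zsemi> blift q = Tlift X E \<Zsemi> T K"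
    and xy [simp]: "x \<in> Arr X" "y \<in> Arr X" "Dom X y = Dom X x" "Cod X x = E" "Cod X y = E"
      "x \<Zsemi> bproj q = y \<Zsemi> bproj q"
  shows "pair x y \<Zsemi> (xi X q \<Zsemi> K) = x"
proof -
  note [simp] = pair_simps pair_lift_zero[OF xy]
  have over': "K \<Zsemi> bproj q = Tproj X E \<Zsemi> bproj q" by (simp add: over naturality)
  have "pair x y \<Zsemi> (xi X q \<Zsemi> K) = Tpair (x \<Zsemi> blift q) (y \<Zsemi> Tzero X E) \<Zsemi> (T (badd q) \<Zsemi> K)"
    using then_comp[OF pair_xi[OF xy], of K] by simp
  also have "\<dots> = pair (x \<Zsemi> (blift q \<Zsemi> K)) (y \<Zsemi> (Tzero X E \<Zsemi> K)) \<Zsemi> badd q"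
    by (subst linear_imp_additive[OF K retr over lin]) simp_all
  also have "\<dots> = pair x (y \<Zsemi> (bproj q \<Zsemi> bzero q)) \<Zsemi> badd q"
    by (simp add: retr linear_imp_preserves_zero[OF K over' lin'])
  also have "y \<Zsemi> (bproj q \<Zsemi> bzero q) = x \<Zsemi> (bproj q \<Zsemi> bzero q)"
    using then_comp[OF xy(6), of "bzero q"] by simp
  also have "pair x (x \<Zsemi> (bproj q \<Zsemi> bzero q)) \<Zsemi> badd q = x"
    using additive_bundle_units(2)[OF additive, of x] by simp
  finally show ?thesis .
qed

end


section \<open>Connectors and retractions onto the vertical bundle\<close>

locale vertical_over = diff_bundle X q
  for X :: "('o, 'm) tangent_data" (structure) and q :: "'m bundle_data" +
  fixes \<iota> TV R :: 'm
  assumes vert: "is_vertical X (bproj q) \<iota> TV"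
    and R [simp]: "R \<in> Arr X" "Dom X R = TObj X E" "Cod X R = Dom X \<iota>"
    and R_over: "R \<Zsemi> (\<iota> \<Zsemi> Tproj X E) = Tproj X E"
begin

abbreviation "K \<equiv> bracket X q (R \<Zsemi> \<iota>)"
abbreviation "V \<equiv> vertical_bundle X (bproj q) \<iota>"

lemmas V_pullbacks = tangent_pullback_iterate[OF vert[unfolded is_vertical_def]]

lemma V_typing [simp]:
  "\<iota> \<in> Arr X" "TV \<in> Arr X" "Cod X \<iota> = TObj X E" "Cod X TV = M" "Dom X TV = Dom X \<iota>"
  using pullback_typing[OF V_pullbacks(1)] by simp_all

lemma V_square: "\<iota> \<Zsemi> T (bproj q) = TV \<Zsemi> Tzero X M"
  by (rule pullback_typing(9)[OF V_pullbacks(1)])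

lemma \<iota>_monic:
  assumes "h \<in> Arr X" "k \<in> Arr X" "Cod X h = Dom X \<iota>" "Cod X k = Dom X \<iota>" "Dom X h = Dom X k"
  shows "h = k \<longleftrightarrow> h \<Zsemi> \<iota> = k \<Zsemi> \<iota>"
proof
  assume eq: "h \<Zsemi> \<iota> = k \<Zsemi> \<iota>"
  show "h = k"
    by (rule pullback_of_split_mono_monic[OF V_pullbacks(1) _ _ _ _ _ _ _ _ eq,
        where r = "Tproj X M"]) (simp_all add: zero_section assms)
qed simp

lemma T_\<iota>_monic:
  assumes "h \<in> Arr X" "k \<in> Arr X" "Cod X h = TObj X (Dom X \<iota>)" "Cod X k = TObj X (Dom X \<iota>)"
    "Dom X h = Dom X k"
  shows "h = k \<longleftrightarrow> h \<Zsemi> T \<iota> = k \<Zsemi> T \<iota>"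
proof
  assume eq: "h \<Zsemi> T \<iota> = k \<Zsemi> T \<iota>"
  have "T (Tzero X M) \<Zsemi> T (Tproj X M) = Id X (TObj X M)"
    by (simp add: zero_section flip: T_comp)
  then show "h = k"
    by - (rule pullback_of_split_mono_monic[OF V_pullbacks(2) _ _ _ _ _ _ _ _ eq,
        where r = "T (Tproj X M)"], simp_all add: assms)
qed simp

lemma factor_through_\<iota>:
  assumes "x \<in> Arr X" "Cod X x = TObj X E" "y \<in> Arr X" "Dom X y = Dom X x" "Cod X y = M"
    "x \<Zsemi> T (bproj q) = y \<Zsemi> Tzero X M"
  shows "\<exists>h. h \<in> Arr X \<and> Dom X h = Dom X x \<and> Cod X h = Dom X \<iota> \<and> h \<Zsemi> \<iota> = x"
  using pairing_into_pullback[OF V_pullbacks(1), of x y] assms by auto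

text \<open>The bracket reads off the first coordinate of \<open>R \<iota>\<^sub>q\<close> in \<open>E\<^sub>2\<close>. That \<open>R\<close> lives over \<open>E\<close> pins
  the second coordinate to \<open>p\<^sub>E\<close>, so that \<open>K\<close> determines \<open>R\<close>.\<close>

lemma bracket_facts:
  "K \<in> Arr X" "Dom X K = TObj X E" "Cod X K = E" "K \<Zsemi> bproj q = Tproj X E \<Zsemi> bproj q"
  "pair K (Tproj X E) \<Zsemi> xi X q = R \<Zsemi> \<iota>"
proof -
  define t where "t = pairing X (xi X q) (bfst q \<Zsemi> bproj q) (R \<Zsemi> \<iota>) (Tproj X E \<Zsemi> bproj q)"
  have "R \<Zsemi> (\<iota> \<Zsemi> (T (bproj q) \<Zsemi> Tproj X M)) = (R \<Zsemi> (\<iota> \<Zsemi> Tproj X E)) \<Zsemi> bproj q"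
    by (simp add: naturality)
  then have base: "R \<Zsemi> (\<iota> \<Zsemi> (T (bproj q) \<Zsemi> Tproj X M)) = Tproj X E \<Zsemi> bproj q"
    by (simp only: R_over)
  have "R \<Zsemi> (\<iota> \<Zsemi> T (bproj q)) = (R \<Zsemi> (\<iota> \<Zsemi> (T (bproj q) \<Zsemi> Tproj X M))) \<Zsemi> Tzero X M"
    by (simp add: V_square V_square[THEN then_comp] zero_section[THEN then_comp])
  then have "R \<Zsemi> (\<iota> \<Zsemi> T (bproj q)) = Tproj X E \<Zsemi> (bproj q \<Zsemi> Tzero X M)"
    by (simp only: base) simp
  then have t [simp]: "t \<in> Arr X" "Dom X t = TObj X E" "Cod X t = Dom X (bfst q)"
    "t \<Zsemi> xi X q = R \<Zsemi> \<iota>" "t \<Zsemi> (bfst q \<Zsemi> bproj q) = Tproj X E \<Zsemi> bproj q"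
    using pairing_into_pullback[OF tangent_pullback_iterate(1)[OF xi_pullback], of "R \<Zsemi> \<iota>"
        "Tproj X E \<Zsemi> bproj q"] by (simp_all flip: t_def)
  have K: "K = t \<Zsemi> bfst q"
    by (simp add: bracket_def t_def base)
  show "K \<in> Arr X" "Dom X K = TObj X E" "Cod X K = E" "K \<Zsemi> bproj q = Tproj X E \<Zsemi> bproj q"
    by (simp_all add: K)
  have tp: "pair (t \<Zsemi> bfst q) (t \<Zsemi> bsnd q) = t"
    by (rule pairing_eqI[OF E2_pullbacks(1)]) simp_all
  have "t \<Zsemi> bsnd q = t \<Zsemi> (xi X q \<Zsemi> Tproj X E)"
    using pair_xi_proj[of "t \<Zsemi> bfst q" "t \<Zsemi> bsnd q"] by (simp add: tp flip: E2_square)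
  also have "\<dots> = Tproj X E"
    using then_comp[OF t(4), of "Tproj X E"] by (simp add: R_over)
  finally show "pair K (Tproj X E) \<Zsemi> xi X q = R \<Zsemi> \<iota>"
    using tp by (simp add: K)
qed

lemmas [simp] = bracket_facts(1-3)

lemma pair_K [simp]:
  "pair K (Tproj X E) \<in> Arr X" "Dom X (pair K (Tproj X E)) = TObj X E"
  "Cod X (pair K (Tproj X E)) = Dom X (bfst q)"
  by (simp_all add: pair_simps bracket_facts(4))

lemma R_\<iota>_comp:
  assumes "k \<in> Arr X" "Dom X k = TObj X E"
  shows "R \<Zsemi> (\<iota> \<Zsemi> k) = pair K (Tproj X E) \<Zsemi> (xi X q \<Zsemi> k)"
  using then_comp[OF bracket_facts(5), of k] assms by simp

lemma T_R_\<iota>: "T R \<Zsemi> T \<iota> = Tpair (T K) (T (Tproj X E)) \<Zsemi> T (xi X q)"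
proof -
  have "T R \<Zsemi> T \<iota> = T (pair K (Tproj X E) \<Zsemi> xi X q)"
    by (simp add: bracket_facts(5))
  then show ?thesis by (simp add: T_pair bracket_facts(4))
qed

lemma T_K_base: "T K \<Zsemi> T (bproj q) = T (Tproj X E) \<Zsemi> T (bproj q)"
  using arg_cong[OF bracket_facts(4), of T] by simp

text \<open>Elements of \<open>TE\<^sub>2\<close> with a common second coordinate are compared after the monic \<open>T\<xi>\<^sub>q\<close>. The
  second coordinates get two names \<open>b\<close>, \<open>d\<close> because they arise as different composites.\<close>

lemma compare_through_xi:
  assumes [simp]: "a \<in> Arr X" "b \<in> Arr X" "c \<in> Arr X" "d \<in> Arr X"
    "Cod X a = TObj X E" "Cod X b = TObj X E" "Cod X c = TObj X E" "Cod X d = TObj X E"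
    "Dom X b = Dom X a" "Dom X c = Dom X a" "Dom X d = Dom X a"
    and ab: "a \<Zsemi> T (bproj q) = b \<Zsemi> T (bproj q)" and cd: "c \<Zsemi> T (bproj q) = d \<Zsemi> T (bproj q)"
    and "b = d"
  shows "Tpair a b \<Zsemi> T (xi X q) = Tpair c d \<Zsemi> T (xi X q) \<longleftrightarrow> a = c"
proof
  note [simp] = Tpair_simps ab cd
  assume eq: "Tpair a b \<Zsemi> T (xi X q) = Tpair c d \<Zsemi> T (xi X q)"
  have "Tpair a b = Tpair c d"
    by (rule T_xi_monic[OF _ _ _ _ _ eq]) simp_all
  from arg_cong[OF this, of "\<lambda>u. u \<Zsemi> T (bfst q)"] show "a = c" by simp
qed (simp add: \<open>b = d\<close>)

text \<open>Both sides of the equation for \<open>R\<close> have the form \<open>\<langle>_, _\<rangle> T\<xi>\<^sub>q\<close>. The second coordinates agree by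
  \<open>l\<^sub>E Tp\<^sub>E = p\<^sub>E z\<^sub>E\<close>.\<close>

lemma linear_over_E_iff:
  "R \<Zsemi> (\<iota> \<Zsemi> Tlift X E) = Tlift X E \<Zsemi> (T R \<Zsemi> T \<iota>) \<longleftrightarrow> K \<Zsemi> blift q = Tlift X E \<Zsemi> T K"
proof -
  note base = bracket_facts(4)
  have lhs: "R \<Zsemi> (\<iota> \<Zsemi> Tlift X E) =
      Tpair (K \<Zsemi> blift q) (Tproj X E \<Zsemi> Tzero X E) \<Zsemi> T (xi X q)"
    using pair_xi_Tlift[of K "Tproj X E"] base by (simp add: R_\<iota>_comp)
  have "Tlift X E \<Zsemi> Tpair (T K) (T (Tproj X E)) = Tpair (Tlift X E \<Zsemi> T K) (Tlift X E \<Zsemi> T (Tproj X E))"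
    by (subst comp_pairing[OF E2_pullbacks(2)]) (simp_all add: T_K_base)
  then have rhs: "Tlift X E \<Zsemi> (T R \<Zsemi> T \<iota>) =
      Tpair (Tlift X E \<Zsemi> T K) (Tlift X E \<Zsemi> T (Tproj X E)) \<Zsemi> T (xi X q)"
    using then_comp[of "Tlift X E" "Tpair (T K) (T (Tproj X E))" _ "T (xi X q)"]
    by (simp add: T_R_\<iota> Tpair_simps T_K_base)
  show ?thesis
    unfolding lhs rhs
    by (rule compare_through_xi)
      (use pair_lift_zero(1)[of K "Tproj X E"] base in
        \<open>simp_all add: T_K_base lift_Tproj lift_Tproj[THEN then_comp]\<close>)
qed

text \<open>Here the second coordinates agree by \<open>Tl\<^sub>q c\<^sub>E Tp\<^sub>E = Tl\<^sub>q p\<^bsub>TE\<^esub> = p\<^sub>E l\<^sub>q\<close>.\<close>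

lemma linear_over_M_iff:
  "R \<Zsemi> (\<iota> \<Zsemi> (T (blift q) \<Zsemi> Tflip X E)) = T (blift q) \<Zsemi> (Tflip X E \<Zsemi> (T R \<Zsemi> T \<iota>))
    \<longleftrightarrow> K \<Zsemi> blift q = T (blift q) \<Zsemi> (Tflip X E \<Zsemi> T K)"
proof -
  note base = bracket_facts(4)
  let ?l = "T (blift q) \<Zsemi> Tflip X E"
  have lhs: "R \<Zsemi> (\<iota> \<Zsemi> (T (blift q) \<Zsemi> Tflip X E)) =
      Tpair (K \<Zsemi> blift q) (Tproj X E \<Zsemi> blift q) \<Zsemi> T (xi X q)"
    using pair_xi_T_lift_flip[of K "Tproj X E"] base by (simp add: R_\<iota>_comp)
  have "?l \<Zsemi> Tpair (T K) (T (Tproj X E)) =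
      Tpair (T (blift q) \<Zsemi> (Tflip X E \<Zsemi> T K)) (T (blift q) \<Zsemi> (Tflip X E \<Zsemi> T (Tproj X E)))"
    by (subst comp_pairing[OF E2_pullbacks(2)]) (simp_all add: T_K_base)
  then have rhs: "T (blift q) \<Zsemi> (Tflip X E \<Zsemi> (T R \<Zsemi> T \<iota>)) =
      Tpair (T (blift q) \<Zsemi> (Tflip X E \<Zsemi> T K)) (T (blift q) \<Zsemi> (Tflip X E \<Zsemi> T (Tproj X E)))
        \<Zsemi> T (xi X q)"
    using then_comp[of ?l "Tpair (T K) (T (Tproj X E))" _ "T (xi X q)"]
    by (simp add: T_R_\<iota> Tpair_simps T_K_base)
  have p: "T (blift q) \<Zsemi> (Tflip X E \<Zsemi> T (Tproj X E)) = Tproj X E \<Zsemi> blift q"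
    by (simp add: flip_proj naturality(1)[of "blift q"])
  have ab: "(K \<Zsemi> blift q) \<Zsemi> T (bproj q) = (Tproj X E \<Zsemi> blift q) \<Zsemi> T (bproj q)"
    using pair_lifts[of K "Tproj X E"] base by simp
  have cd: "(T (blift q) \<Zsemi> (Tflip X E \<Zsemi> T K)) \<Zsemi> T (bproj q) =
      (T (blift q) \<Zsemi> (Tflip X E \<Zsemi> T (Tproj X E))) \<Zsemi> T (bproj q)"
    by (simp add: T_K_base)
  show ?thesis
    unfolding lhs rhs
    by (rule compare_through_xi[OF _ _ _ _ _ _ _ _ _ _ _ ab cd p[symmetric]]) simp_all
qed

text \<open>The lift \<open>l\<^sub>q\<close> is vertical, so \<open>R \<iota>\<^sub>q\<close> fixes it; its coordinates in \<open>E\<^sub>2\<close> are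
  \<open>\<langle>id, q z\<^sub>q\<rangle>\<close>.\<close>

lemma retraction_imp_connector:
  assumes "\<iota> \<Zsemi> R = Id X (Dom X \<iota>)"
  shows "blift q \<Zsemi> K = Id X E"
proof -
  have "\<exists>h. h \<in> Arr X \<and> Dom X h = Dom X (blift q) \<and> Cod X h = Dom X \<iota> \<and> h \<Zsemi> \<iota> = blift q"
    by (rule factor_through_\<iota>[where y = "bproj q"]) (simp_all add: lift_laws(1))
  then obtain h where h [simp]: "h \<in> Arr X" "Dom X h = E" "Cod X h = Dom X \<iota>"
    and hl: "h \<Zsemi> \<iota> = blift q"
    unfolding bundle_typing by blast
  have K_p: "K \<Zsemi> bproj q = Tproj X E \<Zsemi> bproj q" by (rule bracket_facts(4))
  have "blift q \<Zsemi> (R \<Zsemi> \<iota>) = h \<Zsemi> ((\<iota> \<Zsemi> R) \<Zsemi> \<iota>)"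
    using then_comp[OF hl, of "R \<Zsemi> \<iota>"] by simp
  also have "\<dots> = blift q" by (simp add: assms hl)
  finally have "(blift q \<Zsemi> pair K (Tproj X E)) \<Zsemi> xi X q = pair (Id X E) (bproj q \<Zsemi> bzero q) \<Zsemi> xi X q"
    using pair_xi_lift[of "Id X E"] by (simp add: bracket_facts(5))
  from xi_monic[OF _ _ _ _ _ this]
  have "blift q \<Zsemi> pair K (Tproj X E) = pair (Id X E) (bproj q \<Zsemi> bzero q)"
    by (simp add: pair_simps bundle_laws)
  from arg_cong[OF this, of "\<lambda>u. u \<Zsemi> bfst q"] show ?thesis
    by (simp add: pair_simps K_p bundle_laws)
qed

text \<open>Write \<open>\<iota>\<^sub>q = e \<xi>\<^sub>q\<close>. Then \<open>\<iota>\<^sub>q K = e \<xi>\<^sub>q K = e \<pi>\<^sub>1\<close> and \<open>\<iota>\<^sub>q p\<^sub>E = e \<pi>\<^sub>2\<close>, so \<open>R\<close> leaves the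
  coordinates of a vertical vector unchanged.\<close>

lemma connector_imp_retraction:
  assumes retr: "blift q \<Zsemi> K = Id X E"
    and lin: "K \<Zsemi> blift q = T (blift q) \<Zsemi> (Tflip X E \<Zsemi> T K)"
    and lin': "K \<Zsemi> blift q = Tlift X E \<Zsemi> T K"
  shows "\<iota> \<Zsemi> R = Id X (Dom X \<iota>)"
proof -
  note xi_pb = tangent_pullback_iterate(1)[OF xi_pullback]
  define e where "e = pairing X (xi X q) (bfst q \<Zsemi> bproj q) \<iota> TV"
  have e [simp]: "e \<in> Arr X" "Dom X e = Dom X \<iota>" "Cod X e = Dom X (bfst q)"
    and e_xi: "e \<Zsemi> xi X q = \<iota>"
    using pairing_into_pullback[OF xi_pb, of \<iota> TV] by (simp_all add: e_def V_square)
  let ?x = "e \<Zsemi> bfst q" and ?y = "e \<Zsemi> bsnd q"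
  have xy: "?x \<Zsemi> bproj q = ?y \<Zsemi> bproj q" by (simp add: E2_square)
  have e_pair: "pair ?x ?y = e"
    by (rule pairing_eqI[OF E2_pullbacks(1)]) simp_all
  have over: "K \<Zsemi> bproj q = T (bproj q) \<Zsemi> Tproj X M"
    by (simp add: bracket_facts(4) naturality)
  have "\<iota> \<Zsemi> K = pair ?x ?y \<Zsemi> (xi X q \<Zsemi> K)"
    using then_comp[OF e_xi, of K] by (simp add: e_pair)
  also have "\<dots> = ?x"
    using pair_xi_connector[OF bracket_facts(1-3) retr over lin lin', of ?x ?y] xy by simp
  finally have K: "\<iota> \<Zsemi> K = ?x" .
  have p: "\<iota> \<Zsemi> Tproj X E = ?y"
    using then_comp[OF e_xi, of "Tproj X E"] pair_xi_proj[of ?x ?y] xy by (simp add: e_pair)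
  have "\<iota> \<Zsemi> pair K (Tproj X E) = e"
    using e_pair by (subst comp_pairing[OF E2_pullbacks(1)]) (simp_all add: bracket_facts(4) K p)
  from then_comp[OF this, of "xi X q"] have "\<iota> \<Zsemi> (R \<Zsemi> \<iota>) = \<iota>"
    by (simp add: bracket_facts(5) e_xi)
  then show ?thesis
    by (subst \<iota>_monic) simp_all
qed

text \<open>The zero vector over a point \<open>x\<close> of \<open>E\<close> has coordinates \<open>\<langle>x q z\<^sub>q, x\<rangle>\<close> in \<open>E\<^sub>2\<close>.\<close>

lemma zero_through_R_iff:
  assumes H [simp]: "H \<in> Arr X" "Cod X H = TObj X E"
  shows "H \<Zsemi> (R \<Zsemi> \<iota>) = H \<Zsemi> (Tproj X E \<Zsemi> Tzero X E)
    \<longleftrightarrow> H \<Zsemi> K = H \<Zsemi> (Tproj X E \<Zsemi> (bproj q \<Zsemi> bzero q))"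
    (is "?l \<longleftrightarrow> ?r")
proof -
  let ?p = "H \<Zsemi> Tproj X E"
  note base [simp] = bracket_facts(4) and laws [simp] = bundle_laws
  have pair: "H \<Zsemi> pair K (Tproj X E) = pair (H \<Zsemi> K) ?p"
    by (subst comp_pairing[OF E2_pullbacks(1)]) simp_all
  have tau: "H \<Zsemi> (R \<Zsemi> \<iota>) = pair (H \<Zsemi> K) ?p \<Zsemi> xi X q"
    using then_comp[OF pair, of "xi X q"] by (simp add: bracket_facts(5))
  have zero: "H \<Zsemi> (Tproj X E \<Zsemi> Tzero X E) = pair (?p \<Zsemi> (bproj q \<Zsemi> bzero q)) ?p \<Zsemi> xi X q"
    using pair_xi_zero[of ?p] by simp
  show ?thesis
  proof
    assume ?l
    then have "pair (H \<Zsemi> K) ?p \<Zsemi> xi X q = pair (?p \<Zsemi> (bproj q \<Zsemi> bzero q)) ?p \<Zsemi> xi X q"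
      by (simp only: tau zero)
    from xi_monic[OF _ _ _ _ _ this]
    have "pair (H \<Zsemi> K) ?p = pair (?p \<Zsemi> (bproj q \<Zsemi> bzero q)) ?p"
      by (simp add: pair_simps)
    then have "pair (H \<Zsemi> K) ?p \<Zsemi> bfst q = pair (?p \<Zsemi> (bproj q \<Zsemi> bzero q)) ?p \<Zsemi> bfst q"
      by simp
    then show ?r by (simp add: pair_simps)
  qed (simp add: tau zero)
qed

lemma V_proj: "bproj V = \<iota> \<Zsemi> Tproj X E"
  by (simp add: vertical_bundle_def Let_def split: prod.split)

text \<open>The zero and the lift of the vertical bundle are described by definite descriptions, which
  denote because \<open>\<iota>\<^sub>q\<close> and \<open>T\<iota>\<^sub>q\<close> are monic and their universal properties provide a witness.\<close>

lemma V_zero: "bzero V \<in> Arr X" "Dom X (bzero V) = E" "Cod X (bzero V) = Dom X \<iota>"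
  "bzero V \<Zsemi> \<iota> = Tzero X E"
proof -
  have "\<exists>h. h \<in> Arr X \<and> Dom X h = Dom X (Tzero X E) \<and> Cod X h = Dom X \<iota> \<and> h \<Zsemi> \<iota> = Tzero X E"
    by (rule factor_through_\<iota>[where y = "bproj q"]) (simp_all add: zero_T_proj)
  then obtain h where h: "h \<in> Arr X" "Dom X h = E" "Cod X h = Dom X \<iota>" "h \<Zsemi> \<iota> = Tzero X E"
    by auto
  have "bzero V = (THE h. h \<in> hom X E (Dom X \<iota>) \<and> h \<Zsemi> \<iota> = Tzero X E)"
    by (simp add: vertical_bundle_def Let_def split: prod.split)
  also have "\<dots> = h"
    using h by (intro the_equality) (auto simp: hom_iff \<iota>_monic)
  finally show "bzero V \<in> Arr X" "Dom X (bzero V) = E" "Cod X (bzero V) = Dom X \<iota>"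
    "bzero V \<Zsemi> \<iota> = Tzero X E"
    using h by simp_all
qed

lemma V_lift: "blift V \<in> Arr X" "Dom X (blift V) = Dom X \<iota>" "Cod X (blift V) = TObj X (Dom X \<iota>)"
  "blift V \<Zsemi> T \<iota> = \<iota> \<Zsemi> Tlift X E"
proof -
  have "\<iota> \<Zsemi> (Tlift X E \<Zsemi> T (T (bproj q))) = TV \<Zsemi> (Tzero X M \<Zsemi> T (Tzero X M))"
    by (simp add: naturality(3)[symmetric] V_square[THEN then_comp] zero_lift)
  then obtain h where h: "h \<in> Arr X" "Dom X h = Dom X \<iota>" "Cod X h = TObj X (Dom X \<iota>)"
    "h \<Zsemi> T \<iota> = \<iota> \<Zsemi> Tlift X E"
    using pairing_into_pullback[OF V_pullbacks(2), of "\<iota> \<Zsemi> Tlift X E" "TV \<Zsemi> Tzero X M"] by auto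
  have "blift V = (THE h. h \<in> hom X (Dom X \<iota>) (TObj X (Dom X \<iota>)) \<and> h \<Zsemi> T \<iota> = \<iota> \<Zsemi> Tlift X E)"
    by (simp add: vertical_bundle_def Let_def split: prod.split)
  also have "\<dots> = h"
    using h by (intro the_equality) (auto simp: hom_iff T_\<iota>_monic)
  finally show "blift V \<in> Arr X" "Dom X (blift V) = Dom X \<iota>" "Cod X (blift V) = TObj X (Dom X \<iota>)"
    "blift V \<Zsemi> T \<iota> = \<iota> \<Zsemi> Tlift X E"
    using h by simp_all
qed

lemma TV_lift:
  fixes l defines "l \<equiv> blift (TV_bundle X q \<iota> TV)"
  shows "l \<in> Arr X" "Dom X l = Dom X \<iota>" "Cod X l = TObj X (Dom X \<iota>)"
    "l \<Zsemi> T \<iota> = \<iota> \<Zsemi> (T (blift q) \<Zsemi> Tflip X E)"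
proof -
  have Tl: "T (blift q) \<Zsemi> T (T (bproj q)) = T (bproj q) \<Zsemi> T (Tzero X M)"
    using arg_cong[OF lift_laws(1), of T] by simp
  have "\<iota> \<Zsemi> ((T (blift q) \<Zsemi> Tflip X E) \<Zsemi> T (T (bproj q))) =
      \<iota> \<Zsemi> ((T (blift q) \<Zsemi> T (T (bproj q))) \<Zsemi> Tflip X M)"
    by (simp add: naturality(4)[of "bproj q"])
  also have "\<dots> = TV \<Zsemi> (Tzero X M \<Zsemi> T (Tzero X M))"
    by (simp add: Tl flip_zero V_square[THEN then_comp] naturality(2)[of "Tzero X M"])
  finally have par: "\<iota> \<Zsemi> ((T (blift q) \<Zsemi> Tflip X E) \<Zsemi> T (T (bproj q))) =
      TV \<Zsemi> (Tzero X M \<Zsemi> T (Tzero X M))" .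
  have l: "l = pairing X (T \<iota>) (T TV) (\<iota> \<Zsemi> (T (blift q) \<Zsemi> Tflip X E)) (TV \<Zsemi> Tzero X M)"
    by (simp add: l_def TV_bundle_def T_bundle_def Let_def split: prod.split)
  show "l \<in> Arr X" "Dom X l = Dom X \<iota>" "Cod X l = TObj X (Dom X \<iota>)"
    "l \<Zsemi> T \<iota> = \<iota> \<Zsemi> (T (blift q) \<Zsemi> Tflip X E)"
    using pairing_into_pullback[OF V_pullbacks(2), of "\<iota> \<Zsemi> (T (blift q) \<Zsemi> Tflip X E)"
        "TV \<Zsemi> Tzero X M"] par by (simp_all add: l)
qed

lemma R_base: "R \<Zsemi> TV = T (bproj q) \<Zsemi> Tproj X M"
proof -
  \<comment> \<open>\<open>z\<^sub>M p\<^sub>M = id\<close> is inserted so that the vertical square can replace \<open>T\<^sup>Vq\<close> by \<open>\<iota>\<^sub>q\<close>\<close>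
  have "R \<Zsemi> TV = R \<Zsemi> ((TV \<Zsemi> Tzero X M) \<Zsemi> Tproj X M)"
    by (simp add: zero_section)
  also have "\<dots> = (R \<Zsemi> (\<iota> \<Zsemi> Tproj X E)) \<Zsemi> bproj q"
    by (simp add: V_square[symmetric] naturality)
  finally show ?thesis
    by (simp only: R_over) (simp add: naturality)
qed

lemma R_linear_over_E_iff:
  "linear_morphism X (Id X E) R (tangent_bundle X E) V \<longleftrightarrow>
   linear_morphism X (bproj q) K (tangent_bundle X E) q"
proof -
  have "R \<Zsemi> blift V = Tlift X E \<Zsemi> T R \<longleftrightarrow>
      R \<Zsemi> (\<iota> \<Zsemi> Tlift X E) = Tlift X E \<Zsemi> (T R \<Zsemi> T \<iota>)"
    by (subst T_\<iota>_monic) (simp_all add: V_lift)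
  then show ?thesis
    unfolding linear_over_E_iff
    by (simp add: linear_morphism_def tangent_bundle_def hom_iff V_proj R_over bracket_facts(4))
qed

lemma R_linear_over_M_iff:
  "linear_morphism X (Tproj X M) R (T_bundle X q) (TV_bundle X q \<iota> TV) \<longleftrightarrow>
   linear_morphism X (Tproj X M) K (T_bundle X q) q"
proof -
  have "R \<Zsemi> blift (TV_bundle X q \<iota> TV) = T (blift q) \<Zsemi> (Tflip X E \<Zsemi> T R) \<longleftrightarrow>
      R \<Zsemi> (\<iota> \<Zsemi> (T (blift q) \<Zsemi> Tflip X E)) = T (blift q) \<Zsemi> (Tflip X E \<Zsemi> (T R \<Zsemi> T \<iota>))"
    by (subst T_\<iota>_monic) (simp_all add: TV_lift)
  moreover have "bproj (TV_bundle X q \<iota> TV) = TV"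
    by (simp add: TV_bundle_def Let_def split: prod.split)
  ultimately show ?thesis
    unfolding linear_over_M_iff
    by (simp add: linear_morphism_def T_bundle_def hom_iff R_base bracket_facts(4) naturality)
qed

lemma horizontal_zero_iff:
  assumes H [simp]: "H \<in> Arr X" "Cod X H = TObj X E" and Hp: "H \<Zsemi> Tproj X E = qF"
  shows "H \<Zsemi> R = qF \<Zsemi> bzero V \<longleftrightarrow> H \<Zsemi> K = qF \<Zsemi> bproj q \<Zsemi> bzero q"
proof -
  note [simp] = V_zero
  have "H \<Zsemi> R = qF \<Zsemi> bzero V \<longleftrightarrow> H \<Zsemi> (R \<Zsemi> \<iota>) = H \<Zsemi> (Tproj X E \<Zsemi> Tzero X E)"
    by (subst \<iota>_monic) (simp_all flip: Hp)
  then show ?thesis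
    by (simp add: zero_through_R_iff flip: Hp)
qed

lemma linear_ehresmann_iff_koszul:
  assumes F: "is_finsler X (bproj q) qF TF" and H: "H \<in> hom X (Dom X qF) (TObj X E)"
  shows "linear_ehresmann_connection X q \<iota> TV qF TF R H \<longleftrightarrow> koszul_connection X q qF TF K H"
proof -
  have H' [simp]: "H \<in> Arr X" "Dom X H = Dom X qF" "Cod X H = TObj X E"
    using H by (simp_all add: hom_iff)
  have retr: "\<iota> \<Zsemi> R = Id X (Dom X \<iota>) \<longleftrightarrow> blift q \<Zsemi> K = Id X E"
    if "linear_morphism X (Tproj X M) K (T_bundle X q) q"
      "linear_morphism X (bproj q) K (tangent_bundle X E) q"
    using that retraction_imp_connector connector_imp_retraction
    by (auto simp: linear_morphism_def T_bundle_def tangent_bundle_def)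
  have zero: "H \<Zsemi> R = qF \<Zsemi> bzero V \<longleftrightarrow> H \<Zsemi> K = qF \<Zsemi> bproj q \<Zsemi> bzero q"
    if "linear_morphism X (Id X E) H (finsler_bundle X (bproj q) qF TF) (tangent_bundle X E)"
  proof (rule horizontal_zero_iff)
    have "qF \<in> Arr X" "Cod X qF = E"
      using pullback_typing[OF tangent_pullback_iterate(1)[OF F[unfolded is_finsler_def]]] by simp_all
    then show "H \<Zsemi> Tproj X E = qF"
      using that by (simp add: linear_morphism_def finsler_bundle_def tangent_bundle_def Let_def
          split: prod.splits)
  qed simp_all
  show ?thesis
    unfolding linear_ehresmann_connection_def ehresmann_connection_def vertical_connection_def
      horizontal_connection_def koszul_connection_def vertical_koszul_connection_def
      horizontal_koszul_connection_def Let_def R_linear_over_E_iff R_linear_over_M_iff bracket_facts(5)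
    using retr zero by (auto simp: hom_iff)
qed

end

theorem theorem3p55:
  fixes X :: "('o, 'm) tangent_data" (structure)
    and q :: "'m bundle_data"
    and \<iota> TV qF TF R H :: 'm
  assumes "tangent_category X"
    and "differential_bundle X q"
    and "is_vertical X (bproj q) \<iota> TV"
    and "is_finsler X (bproj q) qF TF"
    and "R \<in> hom X (TObj X (Dom X (bproj q))) (Dom X \<iota>)"
    and "H \<in> hom X (Dom X qF) (TObj X (Dom X (bproj q)))"
    and R_over_E: "R \<Zsemi> bproj (vertical_bundle X (bproj q) \<iota>) = Tproj X (Dom X (bproj q))"
  shows "linear_ehresmann_connection X q \<iota> TV qF TF R H \<longleftrightarrow>
         koszul_connection X q qF TF (bracket X q (R \<Zsemi> \<iota>)) H"
proof -
  interpret tangent_category X by fact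
  have "bproj (vertical_bundle X (bproj q) \<iota>) = \<iota> \<Zsemi> Tproj X (Dom X (bproj q))"
    by (simp add: vertical_bundle_def Let_def split: prod.split)
  with assms interpret vertical_over X q \<iota> TV R
    by unfold_locales (simp_all add: hom_iff)
  show ?thesis
    by (rule linear_ehresmann_iff_koszul) fact+
qed

end
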